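(* Let $m\ge1$ and $N\ge K>2m$ be integers, $\mu>0$, $\rho>0$. Let $g\colon\mathbb{R}\to\mathbb{R}$ satisfy (A0)--(A5) of the context and suppose that $$\frac{N}{2m}\,\eta\,C_*^{2_*}\,\rho^{\frac{2m}{N}}<1 .$$ Then neither of the following minimization problems admits a minimizer: $$\inf\left\{J(u): u\in H^m(\mathbb{R}^N)\setminus\{0\},\ \int_{\mathbb{R}^N}|\nabla^m u|^2+\frac{\mu}{|y|^{2m}}u^2\,dx=\frac{N}{2m}\int_{\mathbb{R}^N}H(u)\,dx,\ u\in\mathcal{D}\right\},$$ $$\inf\left\{J(u): u\in H^m(\mathbb{R}^N)\setminus\{0\},\ \int_{\mathbb{R}^N}|\nabla^m u|^2+\frac{\mu}{|y|^{2m}}u^2\,dx=\frac{N}{2m}\int_{\mathbb{R}^N}H(u)\,dx,\ u\in\mathcal{S}\right\}.$$ In particular, the problem $$(-\Delta)^m u+\frac{\mu}{|y|^{2m}}u+\lambda u=g(u)\ \text{ in }\mathbb{R}^N,\qquad\int_{\mathbb{R}^N}|u|^2\,dx=\rho$$ (with unknown $(\lambda,u)$) has no normalized ground state solutions in $H^m(\mathbb{R}^N)$.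
   Context: Write $x=(y,z)\in\mathbb{R}^K\times\mathbb{R}^{N-K}$. Set $\nabla^m u:=\Delta^{m/2}u$ if $m$ is even and $\nabla^m u:=\nabla\Delta^{(m-1)/2}u$ if $m$ is odd. $|\cdot|_k$ is the $L^k(\mathbb{R}^N)$-norm. Here $N>2m$, $2^*:=\frac{2N}{N-2m}$ and $2_*:=2+\frac{4m}{N}$. $\lesssim$ means $\le$ up to a multiplicative constant independent of $s$. $G(s):=\int_0^s g(t)\,dt$, $H(s):=g(s)s-2G(s)$, $h:=H'$. For $f_1,f_2\colon\mathbb{R}\to\mathbb{R}$, $f_1(s)\preceq f_2(s)$ for $s\in\mathbb{R}\setminus\{0\}$ means: $f_1(s)\le f_2(s)$ for all $s\in\mathbb{R}$ and for every $\gamma>0$ there is $s$ with $|s|<\gamma$ and $f_1(s)<f_2(s)$. (A0) $g$ and $h$ are continuous and $|g(s)|+|h(s)|\lesssim|s|+|s|^{2^*-1}$ for every $s\in\mathbb{R}$. (A1) $\eta:=\limsup_{|s|\to0}H(s)/|s|^{2_*}<+\infty$. (A2) $\lim_{|s|\to+\infty}G(s)/|s|^{2_*}=+\infty$. (A3) $\lim_{|s|\to+\infty}g(s)/|s|^{2^*-1}=0$. (A4) $2_*H(s)\preceq h(s)s$ for $s\in\mathbb{R}\setminus\{0\}$. (A5) $0\preceq\frac{4m}{N}G(s)\le H(s)\preceq(2^*-2)G(s)$ for $s\in\mathbb{R}\setminus\{0\}$. $C_*>0$ is the optimal constant in the Gagliardo--Nirenberg inequality $|u|_{2_*}\le C_*|\nabla^m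 u|_2^{\delta}|u|_2^{1-\delta}$, $u\in H^m(\mathbb{R}^N)$, $\delta=\frac Nm\left(\frac12-\frac1{2_*}\right)$. $J(u):=\frac12\int_{\mathbb{R}^N}|\nabla^m u|^2+\frac{\mu}{|y|^{2m}}u^2\,dx-\int_{\mathbb{R}^N}G(u)\,dx$. $\mathcal{S}:=\{u\in L^2(\mathbb{R}^N):\int|u|^2\,dx=\rho\}$, $\mathcal{D}:=\{u\in L^2(\mathbb{R}^N):\int|u|^2\,dx\le\rho\}$. A normalized ground state solution in $H^m(\mathbb{R}^N)$ is a weak solution $u\in\mathcal{S}$ of the equation (for some $\lambda\in\mathbb{R}$) that attains the infimum of $J$ over all $u\in\mathcal{S}\cap H^m(\mathbb{R}^N)\setminus\{0\}$ with $\int|\nabla^m u|^2+\frac{\mu}{|y|^{2m}}u^2\,dx=\frac{N}{2m}\int H(u)\,dx$. *)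

theory Defs
  imports "HOL-Analysis.Analysis"
begin

text \<open>
  Elements of \<open>H\<^sup>m\<close> are represented by Borel measurable functions on \<^typ>\<open>real ^ 'n\<close> with
  \<open>N = CARD('n)\<close>; everything below is invariant under changing them on null sets.
  The splitting \<open>x = (y, z)\<close> is given by the set \<open>Y\<close> of the coordinates that make up \<open>y\<close>, so that
  \<open>K = card Y\<close> and the case \<open>K = N\<close> (no \<open>z\<close> at all) is included.
\<close>

section \<open>Test functions, weak derivatives, Sobolev spaces\<close>

definition partial :: "'n::finite \<Rightarrow> (real ^ 'n \<Rightarrow> real) \<Rightarrow> real ^ 'n \<Rightarrow> real" where
  "partial i f x = frechet_derivative f (at x) (axis i 1)"

text \<open>Multi-indices are lists of coordinates; their order is irrelevant for smooth functions.\<close>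

definition partials :: "'n::finite list \<Rightarrow> (real ^ 'n \<Rightarrow> real) \<Rightarrow> real ^ 'n \<Rightarrow> real" where
  "partials \<alpha> f = foldr partial \<alpha> f"

text \<open>All iterated partial derivatives are differentiable, hence continuous: this is \<open>C\<^sup>\<infinity>\<close>.\<close>

definition test_fun :: "(real ^ 'n::finite \<Rightarrow> real) \<Rightarrow> bool" where
  "test_fun \<phi> \<longleftrightarrow>
     (\<forall>\<alpha> x. partials \<alpha> \<phi> differentiable (at x)) \<and> compact (closure {x. \<phi> x \<noteq> 0})"

definition locally_integrable :: "(real ^ 'n::finite \<Rightarrow> real) \<Rightarrow> bool" where
  "locally_integrable u \<longleftrightarrow>
     u \<in> borel_measurable lborel \<and> (\<forall>B. compact B \<longrightarrow> set_integrable lborel B u)"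

definition weak_deriv ::
    "'n::finite list \<Rightarrow> (real ^ 'n \<Rightarrow> real) \<Rightarrow> (real ^ 'n \<Rightarrow> real) \<Rightarrow> bool" where
  "weak_deriv \<alpha> u v \<longleftrightarrow> locally_integrable u \<and> locally_integrable v \<and>
     (\<forall>\<phi>. test_fun \<phi> \<longrightarrow>
        (LINT x|lborel. u x * partials \<alpha> \<phi> x) = (- 1) ^ length \<alpha> * (LINT x|lborel. v x * \<phi> x))"

text \<open>A representative of the weak derivative, which is unique up to null sets if it exists.\<close>

definition wderiv :: "'n::finite list \<Rightarrow> (real ^ 'n \<Rightarrow> real) \<Rightarrow> real ^ 'n \<Rightarrow> real" where
  "wderiv \<alpha> u = (SOME v. weak_deriv \<alpha> u v)"

definition L2 :: "(real ^ 'n::finite \<Rightarrow> real) set" where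
  "L2 = {u. u \<in> borel_measurable lborel \<and> integrable lborel (\<lambda>x. (u x)\<^sup>2)}"

definition sobolev :: "nat \<Rightarrow> (real ^ 'n::finite \<Rightarrow> real) set" where
  "sobolev m = {u \<in> L2. \<forall>\<alpha>. length \<alpha> \<le> m \<longrightarrow> (\<exists>v\<in>L2. weak_deriv \<alpha> u v)}"

definition wlaplacian :: "(real ^ 'n::finite \<Rightarrow> real) \<Rightarrow> real ^ 'n \<Rightarrow> real" where
  "wlaplacian u x = (\<Sum>i\<in>UNIV. wderiv [i, i] u x)"

definition wgrad :: "(real ^ 'n::finite \<Rightarrow> real) \<Rightarrow> real ^ 'n \<Rightarrow> real ^ 'n" where
  "wgrad u x = (\<chi> i. wderiv [i] u x)"

text \<open>
  The pointwise product \<open>\<nabla>\<^sup>m u \<cdot> \<nabla>\<^sup>m v\<close>; \<open>\<nabla>\<^sup>m u\<close> is scalar for even \<open>m\<close> and a vector for odd \<open>m\<close>.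
  In particular, \<open>nabla_inner m u u x\<close> is the square of the Euclidean norm of \<open>\<nabla>\<^sup>m u\<close> at \<open>x\<close>.
\<close>

definition nabla_inner ::
    "nat \<Rightarrow> (real ^ 'n::finite \<Rightarrow> real) \<Rightarrow> (real ^ 'n \<Rightarrow> real) \<Rightarrow> real ^ 'n \<Rightarrow> real" where
  "nabla_inner m u v x =
     (if even m then (wlaplacian ^^ (m div 2)) u x * (wlaplacian ^^ (m div 2)) v x
      else wgrad ((wlaplacian ^^ ((m - 1) div 2)) u) x \<bullet> wgrad ((wlaplacian ^^ ((m - 1) div 2)) v) x)"

section \<open>Exponents and assumptions on the nonlinearity\<close>

definition sobolev_exp :: "nat \<Rightarrow> nat \<Rightarrow> real" where
  "sobolev_exp N m = 2 * real N / (real N - 2 * real m)"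

definition mass_exp :: "nat \<Rightarrow> nat \<Rightarrow> real" where
  "mass_exp N m = 2 + 4 * real m / real N"

definition G_of :: "(real \<Rightarrow> real) \<Rightarrow> real \<Rightarrow> real" where
  "G_of g s = (LBINT t=0..ereal s. g t)"

definition H_of :: "(real \<Rightarrow> real) \<Rightarrow> real \<Rightarrow> real" where
  "H_of g s = g s * s - 2 * G_of g s"

definition h_of :: "(real \<Rightarrow> real) \<Rightarrow> real \<Rightarrow> real" where
  "h_of g = deriv (H_of g)"

definition prec_le :: "(real \<Rightarrow> real) \<Rightarrow> (real \<Rightarrow> real) \<Rightarrow> bool" where
  "prec_le f1 f2 \<longleftrightarrow> (\<forall>s. f1 s \<le> f2 s) \<and> (\<forall>\<gamma>>0. \<exists>s. \<bar>s\<bar> < \<gamma> \<and> f1 s < f2 s)"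

definition eta :: "nat \<Rightarrow> nat \<Rightarrow> (real \<Rightarrow> real) \<Rightarrow> ereal" where
  "eta N m g = Limsup (at 0) (\<lambda>s. ereal (H_of g s / \<bar>s\<bar> powr mass_exp N m))"

text \<open>The differentiability of \<open>H\<close> is implicit in the use of \<open>h = H'\<close>.\<close>

definition A0 :: "nat \<Rightarrow> nat \<Rightarrow> (real \<Rightarrow> real) \<Rightarrow> bool" where
  "A0 N m g \<longleftrightarrow>
     continuous_on UNIV g \<and>
     (\<forall>s. H_of g field_differentiable (at s)) \<and> continuous_on UNIV (h_of g) \<and>
     (\<exists>C. \<forall>s. \<bar>g s\<bar> + \<bar>h_of g s\<bar> \<le> C * (\<bar>s\<bar> + \<bar>s\<bar> powr (sobolev_exp N m - 1)))"

definition A1 :: "nat \<Rightarrow> nat \<Rightarrow> (real \<Rightarrow> real) \<Rightarrow> bool" where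
  "A1 N m g \<longleftrightarrow> eta N m g < \<infinity>"

definition A2 :: "nat \<Rightarrow> nat \<Rightarrow> (real \<Rightarrow> real) \<Rightarrow> bool" where
  "A2 N m g \<longleftrightarrow> filterlim (\<lambda>s. G_of g s / \<bar>s\<bar> powr mass_exp N m) at_top at_infinity"

definition A3 :: "nat \<Rightarrow> nat \<Rightarrow> (real \<Rightarrow> real) \<Rightarrow> bool" where
  "A3 N m g \<longleftrightarrow> ((\<lambda>s. g s / \<bar>s\<bar> powr (sobolev_exp N m - 1)) \<longlongrightarrow> 0) at_infinity"

definition A4 :: "nat \<Rightarrow> nat \<Rightarrow> (real \<Rightarrow> real) \<Rightarrow> bool" where
  "A4 N m g \<longleftrightarrow> prec_le (\<lambda>s. mass_exp N m * H_of g s) (\<lambda>s. h_of g s * s)"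

definition A5 :: "nat \<Rightarrow> nat \<Rightarrow> (real \<Rightarrow> real) \<Rightarrow> bool" where
  "A5 N m g \<longleftrightarrow>
     prec_le (\<lambda>s. 0) (\<lambda>s. 4 * real m / real N * G_of g s) \<and>
     (\<forall>s. 4 * real m / real N * G_of g s \<le> H_of g s) \<and>
     prec_le (H_of g) (\<lambda>s. (sobolev_exp N m - 2) * G_of g s)"

section \<open>The optimal Gagliardo--Nirenberg constant\<close>

definition Lnorm :: "real \<Rightarrow> (real ^ 'n::finite \<Rightarrow> real) \<Rightarrow> real" where
  "Lnorm k u = (LINT x|lborel. \<bar>u x\<bar> powr k) powr (1 / k)"

definition GN_delta :: "nat \<Rightarrow> nat \<Rightarrow> real" where
  "GN_delta N m = real N / real m * (1 / 2 - 1 / mass_exp N m)"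

text \<open>
  The Gagliardo--Nirenberg inequality with constant \<open>C\<close>. Since \<open>Lnorm\<close> is zero on functions with
  infinite norm, the finiteness of the left-hand side has to be stated.
\<close>

definition GN_inequality :: "'n::finite itself \<Rightarrow> nat \<Rightarrow> real \<Rightarrow> bool" where
  "GN_inequality _ m C \<longleftrightarrow>
     (\<forall>u \<in> (sobolev m :: (real ^ 'n \<Rightarrow> real) set).
        integrable lborel (\<lambda>x. \<bar>u x\<bar> powr mass_exp CARD('n) m) \<and>
        Lnorm (mass_exp CARD('n) m) u
          \<le> C * Lnorm 2 (\<lambda>x. sqrt (nabla_inner m u u x)) powr GN_delta CARD('n) m
              * Lnorm 2 u powr (1 - GN_delta CARD('n) m))"

definition GN_optimal :: "'n::finite itself \<Rightarrow> nat \<Rightarrow> real \<Rightarrow> bool" where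
  "GN_optimal T m C \<longleftrightarrow> C > 0 \<and> GN_inequality T m C \<and> (\<forall>C'. GN_inequality T m C' \<longrightarrow> C \<le> C')"

section \<open>Energy, constraints, solutions\<close>

definition hardy_weight :: "nat \<Rightarrow> real \<Rightarrow> 'n::finite set \<Rightarrow> real ^ 'n \<Rightarrow> real" where
  "hardy_weight m \<mu> Y x = \<mu> / L2_set (\<lambda>i. x $ i) Y ^ (2 * m)"

definition quad_density ::
    "nat \<Rightarrow> real \<Rightarrow> 'n::finite set \<Rightarrow> (real ^ 'n \<Rightarrow> real) \<Rightarrow> real ^ 'n \<Rightarrow> real" where
  "quad_density m \<mu> Y u x = nabla_inner m u u x + hardy_weight m \<mu> Y x * (u x)\<^sup>2"

definition J ::
    "nat \<Rightarrow> real \<Rightarrow> 'n::finite set \<Rightarrow> (real \<Rightarrow> real) \<Rightarrow> (real ^ 'n \<Rightarrow> real) \<Rightarrow> real" where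
  "J m \<mu> Y g u =
     1 / 2 * (LINT x|lborel. quad_density m \<mu> Y u x) - (LINT x|lborel. G_of g (u x))"

definition mass_sphere :: "real \<Rightarrow> (real ^ 'n::finite \<Rightarrow> real) set" where
  "mass_sphere \<rho> = {u \<in> L2. (LINT x|lborel. (u x)\<^sup>2) = \<rho>}"

definition mass_ball :: "real \<Rightarrow> (real ^ 'n::finite \<Rightarrow> real) set" where
  "mass_ball \<rho> = {u \<in> L2. (LINT x|lborel. (u x)\<^sup>2) \<le> \<rho>}"

text \<open>
  An equality between integrals of \<^const>\<open>lborel\<close>-functions includes that both integrals are
  finite, since a divergent Bochner integral is zero by convention. (For \<open>u \<in> H\<^sup>m\<close> and \<open>2 m < K\<close>
  the finiteness is automatic by the Hardy--Rellich and Sobolev inequalities.)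
\<close>

definition constraint_set ::
    "nat \<Rightarrow> real \<Rightarrow> 'n::finite set \<Rightarrow> (real \<Rightarrow> real) \<Rightarrow> (real ^ 'n \<Rightarrow> real) set" where
  "constraint_set m \<mu> Y g =
     {u \<in> sobolev m. \<not> (AE x in lborel. u x = 0) \<and>
        integrable lborel (quad_density m \<mu> Y u) \<and> integrable lborel (\<lambda>x. H_of g (u x)) \<and>
        (LINT x|lborel. quad_density m \<mu> Y u x)
          = real CARD('n) / (2 * real m) * (LINT x|lborel. H_of g (u x))}"

definition weak_solution ::
    "nat \<Rightarrow> real \<Rightarrow> 'n::finite set \<Rightarrow> (real \<Rightarrow> real) \<Rightarrow> real \<Rightarrow> (real ^ 'n \<Rightarrow> real) \<Rightarrow> bool" where
  "weak_solution m \<mu> Y g lam u \<longleftrightarrow> u \<in> sobolev m \<and>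
     (\<forall>\<phi>. test_fun \<phi> \<longrightarrow>
        integrable lborel
          (\<lambda>x. nabla_inner m u \<phi> x + hardy_weight m \<mu> Y x * u x * \<phi> x + lam * u x * \<phi> x) \<and>
        integrable lborel (\<lambda>x. g (u x) * \<phi> x) \<and>
        (LINT x|lborel. nabla_inner m u \<phi> x + hardy_weight m \<mu> Y x * u x * \<phi> x + lam * u x * \<phi> x)
          = (LINT x|lborel. g (u x) * \<phi> x))"

definition normalized_ground_state ::
    "nat \<Rightarrow> real \<Rightarrow> 'n::finite set \<Rightarrow> (real \<Rightarrow> real) \<Rightarrow> real \<Rightarrow> real \<Rightarrow> (real ^ 'n \<Rightarrow> real) \<Rightarrow> bool" where
  "normalized_ground_state m \<mu> Y g \<rho> lam u \<longleftrightarrow>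
     u \<in> mass_sphere \<rho> \<and> weak_solution m \<mu> Y g lam u \<and>
     is_arg_min (J m \<mu> Y g) (\<lambda>v. v \<in> constraint_set m \<mu> Y g \<inter> mass_sphere \<rho>) u"

end

theory Submission
  imports Defs
begin

text \<open>
  The potential \<open>\<mu> / |y|\<^sup>2\<^sup>m\<close> is repulsive and not invariant under translations in \<open>y\<close>, so energy can be gained by
  moving a function away from the singular set. Every function on the constraint can therefore be replaced
  by another one with the same \<open>L\<^sup>2\<close>-norm and strictly smaller energy (lemma \<open>exists_lower_energy\<close>), which rules
  out minimizers on the ball and on the sphere alike, and with them normalized ground states.

  In detail, let \<open>u\<close> be on the constraint. A suitable translation \<open>v\<close> of \<open>u\<close> has the same integrals of \<open>|\<nabla>\<^sup>m u|\<^sup>2\<close>, \<open>G u\<close> and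
  \<open>H u\<close>, but strictly smaller potential energy: averaging the weight over a large cube of translations shows
  that some translations make the potential energy arbitrarily small, because the weight is locally integrable for
  \<open>2 m < card Y\<close> and homogeneous of degree \<open>- 2 m\<close> (\<open>exists_translation_small_hardy\<close>).
  Now \<open>v\<close> lies off the constraint, its quadratic form being too small. The dilations
  \<open>w x = s\<^sup>N\<^sup>/\<^sup>2 v (s x)\<close> preserve the \<open>L\<^sup>2\<close>-norm and multiply the quadratic form by \<open>s\<^sup>2\<^sup>m\<close>, and \<open>w\<close> is on the constraint if
  and only if the quadratic form of \<open>v\<close> equals \<open>N / (2 m)\<close> times \<open>r\<^sup>-\<^sup>p \<integral> H (r u)\<close>, where \<open>r = s\<^sup>N\<^sup>/\<^sup>2\<close> and \<open>p\<close> is the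
  mass-critical exponent. At \<open>r = 1\<close> the latter is too large; as \<open>r \<rightarrow> 0\<close> its limes superior is at most
  \<open>N / (2 m) \<eta> \<integral> |u|\<^sup>p\<close>, and by the Gagliardo--Nirenberg inequality and the smallness condition this is less than
  \<open>\<integral> |\<nabla>\<^sup>m u|\<^sup>2\<close> and so too small. By continuity there is a suitable \<open>s \<le> 1\<close>
  (\<open>GN_mass_critical\<close>, \<open>exists_scale_with_prescribed_H\<close>). Finally, the same dilation of \<open>u\<close> itself does not raise the
  energy, since (A4) makes the energy maximal at \<open>s = 1\<close> among \<open>s \<le> 1\<close> (\<open>fiber_energy_le\<close>), and \<open>w\<close> has strictly
  smaller energy than that dilation.

  Making this precise requires that \<open>\<nabla>\<^sup>m\<close> commutes with dilations and translations up to the expected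
  factor. As \<open>wderiv\<close> is an arbitrary choice among weak derivatives, this rests on their uniqueness, that is,
  on the fundamental lemma of the calculus of variations.
\<close>

section \<open>Smooth bump functions\<close>

lemma partial_eqI:
  assumes "(f has_derivative f') (at x)"
  shows "partial k f x = f' (axis k 1)"
  using frechet_derivative_at[OF assms] by (simp add: partial_def)

lemma partials_append: "partials (\<alpha> @ \<beta>) f = partials \<alpha> (partials \<beta> f)"
  by (simp add: partials_def)

lemma partials_Nil [simp]: "partials [] f = f"
  by (simp add: partials_def)

lemma partials_Cons [simp]: "partials (i # \<alpha>) f = partial i (partials \<alpha> f)"
  by (simp add: partials_def)

text \<open>
  The functions \<open>p (1 / t) exp (- 1 / t)\<close> of \<open>t > 0\<close>, extended by zero. Carrying the polynomial \<open>p\<close> along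
  makes the family closed under differentiation, so that smoothness needs a single derivative formula.
\<close>

definition flat :: "real poly \<Rightarrow> real \<Rightarrow> real" where
  "flat p t = (if t > 0 then poly p (1 / t) * exp (- (1 / t)) else 0)"

lemma poly_times_exp_tendsto_0: "((\<lambda>z. poly p z * exp (- z)) \<longlongrightarrow> 0) at_top" for p :: "real poly"
proof -
  have "((\<lambda>z. \<Sum>i\<le>degree p. coeff p i * (z ^ i / exp z)) \<longlongrightarrow> (\<Sum>i\<le>degree p. coeff p i * 0)) at_top"
    by (intro tendsto_sum tendsto_mult tendsto_const tendsto_power_div_exp_0)
  then show ?thesis
    by (simp add: poly_altdef exp_minus sum_distrib_right divide_inverse mult.assoc)
qed

lemma flat_has_derivative:
  "(flat p has_real_derivative flat ([:0, 0, 1:] * (p - pderiv p)) t) (at t)"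
proof -
  consider "t > 0" | "t < 0" | "t = 0" by linarith
  then show ?thesis
  proof cases
    case 1
    have "((\<lambda>t. poly p (1 / t) * exp (- (1 / t))) has_real_derivative
            flat ([:0, 0, 1:] * (p - pderiv p)) t) (at t)"
      using 1 by (auto intro!: derivative_eq_intros DERIV_chain2[OF poly_DERIV]
          simp: flat_def field_simps power2_eq_square)
    then show ?thesis
      by (rule DERIV_cong_ev[THEN iffD2, rotated -1, OF _ refl])
        (use 1 in \<open>auto simp: flat_def intro!: eventually_mono[OF eventually_nhds_in_open[of "{0<..}"]]\<close>)
  next
    case 2
    have "((\<lambda>t. 0) has_real_derivative flat ([:0, 0, 1:] * (p - pderiv p)) t) (at t)"
      using 2 by (auto simp: flat_def)
    then show ?thesis
      by (rule DERIV_cong_ev[THEN iffD2, rotated -1, OF _ refl])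
        (use 2 in \<open>auto simp: flat_def intro!: eventually_mono[OF eventually_nhds_in_open[of "{..<0}"]]\<close>)
  next
    case 3
    have "((\<lambda>h. poly (pCons 0 p) (inverse h) * exp (- inverse h)) \<longlongrightarrow> 0) (at_right 0)"
      by (rule filterlim_compose[OF poly_times_exp_tendsto_0 filterlim_inverse_at_top_right])
    then have r: "((\<lambda>h. flat p h / h) \<longlongrightarrow> 0) (at_right 0)"
      by (rule Lim_transform_eventually)
        (auto simp: flat_def eventually_at_filter field_simps)
    have l: "((\<lambda>h. flat p h / h) \<longlongrightarrow> 0) (at_left 0)"
      by (rule Lim_transform_eventually[OF tendsto_const])
        (auto simp: flat_def eventually_at_filter)
    have "((\<lambda>h. flat p h / h) \<longlongrightarrow> 0) (at 0)"
      using l r by (simp add: filterlim_at_split)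
    then show ?thesis
      using 3 by (simp add: DERIV_def flat_def)
  qed
qed

text \<open>
  An algebra of functions on \<open>\<real>\<^sup>N\<close> that is visibly closed under partial derivatives. Since each member is
  differentiable, so are all its iterated partial derivatives.
\<close>

inductive smooth_alg :: "(real ^ 'n::finite \<Rightarrow> real) \<Rightarrow> bool" where
  const: "smooth_alg (\<lambda>x. c)"
| base: "smooth_alg (\<lambda>x. flat p (c * x $ i + d))"
| add: "smooth_alg f \<Longrightarrow> smooth_alg g \<Longrightarrow> smooth_alg (\<lambda>x. f x + g x)"
| mult: "smooth_alg f \<Longrightarrow> smooth_alg g \<Longrightarrow> smooth_alg (\<lambda>x. f x * g x)"

lemma smooth_alg_partial:
  assumes "smooth_alg f"
  shows "(\<forall>x. f differentiable (at x)) \<and> smooth_alg (partial k f)"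
  using assms
proof induction
  case (const c)
  have "partial k (\<lambda>x. c) = (\<lambda>x. 0)"
    by (intro ext partial_eqI) auto
  then show ?case by (auto intro: smooth_alg.const)
next
  case (base p c i d)
  let ?q = "[:0, 0, 1:] * (p - pderiv p)"
  have D: "((\<lambda>x. flat p (c * x $ i + d)) has_derivative
      (\<lambda>h. flat ?q (c * x $ i + d) * (c * h $ i))) (at x)" for x :: "real ^ 'a"
  proof -
    have "((\<lambda>x. c * x $ i + d) has_derivative (\<lambda>h. c * h $ i)) (at x)"
      by (auto intro!: derivative_eq_intros bounded_linear.has_derivative[OF bounded_linear_vec_nth])
    from has_derivative_compose[OF this flat_has_derivative[THEN has_field_derivative_imp_has_derivative]]
    show ?thesis by simp
  qed
  have "partial k (\<lambda>x. flat p (c * x $ i + d)) =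
      (\<lambda>x. flat (if k = i then smult c ?q else 0) (c * x $ i + d))"
    by (intro ext) (subst partial_eqI[OF D], auto simp: flat_def axis_def algebra_simps)
  then show ?case
    using D by (auto simp: differentiable_def intro: smooth_alg.const smooth_alg.base)
next
  case (add f g)
  have "partial k (\<lambda>x. f x + g x) = (\<lambda>x. partial k f x + partial k g x)"
  proof
    fix x
    have "((\<lambda>x. f x + g x) has_derivative (\<lambda>h. frechet_derivative f (at x) h +
        frechet_derivative g (at x) h)) (at x)"
      using add.IH by (intro has_derivative_add) (auto simp: frechet_derivative_works[symmetric])
    from partial_eqI[OF this] show "partial k (\<lambda>x. f x + g x) x = partial k f x + partial k g x"
      by (simp add: partial_def)
  qed
  then show ?case
    using add by (auto intro: smooth_alg.add)
next
  case (mult f g)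
  have "partial k (\<lambda>x. f x * g x) = (\<lambda>x. f x * partial k g x + partial k f x * g x)"
  proof
    fix x
    have "((\<lambda>x. f x * g x) has_derivative (\<lambda>h. f x * frechet_derivative g (at x) h +
        frechet_derivative f (at x) h * g x)) (at x)"
      using mult.IH by (intro has_derivative_mult) (auto simp: frechet_derivative_works[symmetric])
    from partial_eqI[OF this] show "partial k (\<lambda>x. f x * g x) x = f x * partial k g x + partial k f x * g x"
      by (simp add: partial_def)
  qed
  then show ?case
    using mult by (auto intro!: smooth_alg.add smooth_alg.mult)
qed

lemma smooth_alg_partials: "smooth_alg f \<Longrightarrow> smooth_alg (partials \<alpha> f)"
  by (induction \<alpha>) (simp_all add: smooth_alg_partial)

lemma smooth_alg_prod:
  assumes "finite I" "\<And>i. i \<in> I \<Longrightarrow> smooth_alg (f i)"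
  shows "smooth_alg (\<lambda>x. \<Prod>i\<in>I. f i x)"
  using assms by (induction I rule: finite_induct) (auto intro: smooth_alg.intros)

text \<open>
  Products of \<open>exp (- 1 / (k t))\<close> over the distances \<open>t\<close> to the faces of \<open>box a b\<close>. For \<open>k \<rightarrow> \<infinity>\<close> each factor tends to
  \<open>1\<close> inside the box, so the bumps converge to the indicator function of the box; bounds and supports
  do not depend on \<open>k\<close>.
\<close>

definition bump :: "real ^ 'n::finite \<Rightarrow> real ^ 'n \<Rightarrow> real \<Rightarrow> real ^ 'n \<Rightarrow> real" where
  "bump a b k x = (\<Prod>i\<in>UNIV. flat 1 (k * x $ i + - k * a $ i) * flat 1 (- k * x $ i + k * b $ i))"

lemma flat_1: "0 \<le> flat 1 t" "flat 1 t \<le> 1"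
  by (simp_all add: flat_def)

lemma bump_bounds: "0 \<le> bump a b k x" "bump a b k x \<le> 1"
  unfolding bump_def
  by (intro prod_nonneg prod_le_1 conjI mult_nonneg_nonneg mult_le_one flat_1 ballI)+

lemma bump_outside:
  assumes "k > 0" "x \<notin> box a b"
  shows "bump a b k x = 0"
proof -
  obtain i where "x $ i \<le> a $ i \<or> b $ i \<le> x $ i"
    using assms(2) by (auto simp: mem_box_cart not_less)
  then have "k * x $ i + - k * a $ i \<le> 0 \<or> - k * x $ i + k * b $ i \<le> 0"
    using assms(1) by auto
  then have "flat 1 (k * x $ i + - k * a $ i) * flat 1 (- k * x $ i + k * b $ i) = 0"
    by (auto simp: flat_def)
  then show ?thesis
    unfolding bump_def by (intro prod_zero) auto
qed

lemma test_fun_bump: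
  assumes "k > 0"
  shows "test_fun (bump a b k)"
  unfolding test_fun_def
proof (intro conjI allI)
  have "smooth_alg (bump a b k)"
    unfolding bump_def by (intro smooth_alg_prod smooth_alg.mult smooth_alg.base) auto
  then show "partials \<alpha> (bump a b k) differentiable (at x)" for \<alpha> x
    using smooth_alg_partial smooth_alg_partials by blast
  have "{x. bump a b k x \<noteq> 0} \<subseteq> cbox a b"
    using bump_outside[OF assms] box_subset_cbox by blast
  then show "compact (closure {x. bump a b k x \<noteq> 0})"
    by (meson bounded_cbox bounded_subset compact_closure)
qed

lemma flat_1_tendsto:
  assumes "t > 0"
  shows "(\<lambda>k. flat 1 (real (Suc k) * t)) \<longlonglongrightarrow> 1"
proof -
  have "(\<lambda>k. exp (- (inverse t * inverse (real (Suc k))))) \<longlonglongrightarrow> exp (- (inverse t * 0))"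
    by (intro tendsto_intros LIMSEQ_inverse_real_of_nat)
  then show ?thesis
    using assms by (simp add: flat_def mult_pos_pos divide_inverse del: of_nat_Suc) (simp add: mult.commute)
qed

lemma bump_tendsto: "(\<lambda>k. bump a b (real (Suc k)) x) \<longlonglongrightarrow> indicator (box a b) x"
proof (cases "x \<in> box a b")
  case True
  have "(\<lambda>k. \<Prod>i\<in>UNIV. flat 1 (real (Suc k) * (x $ i - a $ i)) * flat 1 (real (Suc k) * (b $ i - x $ i)))
      \<longlonglongrightarrow> (\<Prod>i\<in>(UNIV::'a set). 1 * 1)"
    using True by (intro tendsto_prod tendsto_mult flat_1_tendsto) (auto simp: mem_box_cart)
  then show ?thesis
    using True by (simp add: bump_def algebra_simps)
next
  case False
  then show ?thesis by (simp add: bump_outside)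
qed

section \<open>The fundamental lemma of the calculus of variations\<close>

lemma integral_box_eq_0:
  assumes f: "locally_integrable f" and orth: "\<And>\<phi>. test_fun \<phi> \<Longrightarrow> (LINT x|lborel. f x * \<phi> x) = 0"
  shows "(LINT x|lborel. f x * indicator (box a b) x) = 0"
proof -
  have [measurable]: "f \<in> borel_measurable lborel"
    using f by (simp add: locally_integrable_def)
  have m: "bump a b k \<in> borel_measurable lborel" if "k > 0" for k :: real
  proof -
    have "continuous_on UNIV (partials [] (bump a b k))"
      using test_fun_bump[OF that, of a b] unfolding test_fun_def
      by (meson continuous_at_imp_continuous_on differentiable_imp_continuous_within)
    then show ?thesis by (simp add: borel_measurable_continuous_onI)
  qed
  have "(\<lambda>k. LINT x|lborel. f x * bump a b (real (Suc k)) x) \<longlonglongrightarrow>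
      (LINT x|lborel. f x * indicator (box a b) x)"
  proof (rule integral_dominated_convergence[where w = "\<lambda>x. \<bar>f x\<bar> * indicator (cbox a b) x"])
    have "set_integrable lborel (cbox a b) f"
      using f by (simp add: locally_integrable_def)
    then show "integrable lborel (\<lambda>x. \<bar>f x\<bar> * indicator (cbox a b) x)"
      using set_integrable_abs by (fastforce simp: set_integrable_def mult.commute)
    show "AE x in lborel. norm (f x * bump a b (real (Suc k)) x) \<le> \<bar>f x\<bar> * indicator (cbox a b) x" for k
    proof (rule AE_I2)
      fix x
      show "norm (f x * bump a b (real (Suc k)) x) \<le> \<bar>f x\<bar> * indicator (cbox a b) x"
      proof (cases "x \<in> box a b")
        case True
        then have "x \<in> cbox a b" using box_subset_cbox by blast
        then show ?thesis
          by (auto simp: abs_mult bump_bounds intro!: mult_left_le)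
      qed (simp add: bump_outside)
    qed
    show "AE x in lborel. (\<lambda>k. f x * bump a b (real (Suc k)) x) \<longlonglongrightarrow> f x * indicator (box a b) x"
      by (intro AE_I2 tendsto_intros bump_tendsto)
    show "(\<lambda>x. f x * bump a b (real (Suc k)) x) \<in> borel_measurable lborel" for k
      using m[of "real (Suc k)"] by measurable
  qed measurable
  then show ?thesis
    using LIMSEQ_unique[OF _ tendsto_const[of 0]] by (simp add: orth test_fun_bump)
qed

text \<open>
  The densities \<open>f\<^sup>+\<close> and \<open>f\<^sup>-\<close> define measures that agree on boxes, hence on all Borel sets, hence
  \<open>f\<^sup>+ = f\<^sup>-\<close> almost everywhere.
\<close>

lemma AE_eq_0_if_box_integrals_0:
  fixes f :: "real ^ 'n::finite \<Rightarrow> real"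
  assumes f: "locally_integrable f"
    and box: "\<And>a b. (LINT x|lborel. f x * indicator (box a b) x) = 0"
  shows "AE x in lborel. f x = 0"
proof -
  have [measurable]: "f \<in> borel_measurable borel"
    using f by (simp add: locally_integrable_def)
  have int: "integrable lborel (\<lambda>x. f x * indicator (box a b) x)" for a b
  proof -
    have "set_integrable lborel (cbox a b) f"
      using f by (simp add: locally_integrable_def)
    then have "set_integrable lborel (box a b) f"
      by (rule set_integrable_subset) (auto simp: box_subset_cbox)
    then show ?thesis by (simp add: set_integrable_def mult.commute)
  qed
  let ?M = "density lborel (\<lambda>x. ennreal (f x))" and ?N = "density lborel (\<lambda>x. ennreal (- f x))"
  have M: "emeasure ?M (box a b) = (\<integral>\<^sup>+x. ennreal (f x * indicator (box a b) x) \<partial>lborel)" for a b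
    by (subst emeasure_density) (auto intro!: nn_integral_cong simp: indicator_def)
  have N: "emeasure ?N (box a b) = (\<integral>\<^sup>+x. ennreal (- (f x * indicator (box a b) x)) \<partial>lborel)" for a b
    by (subst emeasure_density) (auto intro!: nn_integral_cong simp: indicator_def)
  have fin: "(\<integral>\<^sup>+x. ennreal (f x * indicator (box a b) x) \<partial>lborel) < top"
    "(\<integral>\<^sup>+x. ennreal (- (f x * indicator (box a b) x)) \<partial>lborel) < top" for a b
    using int[of a b] by (simp_all add: real_integrable_def top.not_eq_extremum)
  have eq: "emeasure ?M (box a b) = emeasure ?N (box a b)" for a b
  proof -
    have "enn2real (emeasure ?M (box a b)) = enn2real (emeasure ?N (box a b))"
      using box[of a b] unfolding M N real_lebesgue_integral_def[OF int] by simp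
    then show ?thesis
      using fin[of a b] by (metis M N ennreal_enn2real)
  qed
  have "?M = ?N"
  proof (rule measure_eqI_generator_eq[where \<Omega> = UNIV and E = "range (\<lambda>(a, b). box a b)"
        and A = "\<lambda>n. box (- (real n *\<^sub>R One)) (real n *\<^sub>R One)"])
    show "Int_stable (range (\<lambda>(a, b). box a b :: (real ^ 'n) set))"
      by (auto simp: Int_stable_def box_Int_box)
    show "sets ?M = sigma_sets UNIV (range (\<lambda>(a, b). box a b))"
      "sets ?N = sigma_sets UNIV (range (\<lambda>(a, b). box a b))"
      by (simp_all add: borel_eq_box)
    show "(\<Union>n. box (- (real n *\<^sub>R One)) (real n *\<^sub>R One)) = (UNIV :: (real ^ 'n) set)"
      using UN_box_eq_UNIV by simp
    show "emeasure ?M (box (- (real n *\<^sub>R One)) (real n *\<^sub>R One)) \<noteq> \<infinity>" for n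
      using fin(1) by (simp add: M less_top)
  qed (auto simp: eq)
  then have "AE x in lborel. ennreal (f x) = ennreal (- f x)"
    by (intro sigma_finite_measure.density_unique[OF sigma_finite_lborel]) auto
  then show ?thesis
    by eventually_elim (metis add.inverse_inverse ennreal_eq_0_iff ennreal_neg linear neg_0_le_iff_le neg_le_0_iff_le order_antisym)
qed

text \<open>
  The fundamental lemma of the calculus of variations. Its role is the uniqueness of weak derivatives:
  \<open>wderiv\<close> picks an arbitrary representative, and nothing can be said about how it transforms unless all
  representatives agree almost everywhere.
\<close>

lemma AE_eq_0_if_orthogonal_to_test_funs:
  assumes "locally_integrable f" "\<And>\<phi>. test_fun \<phi> \<Longrightarrow> (LINT x|lborel. f x * \<phi> x) = 0"
  shows "AE x in lborel. f x = 0"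
  using assms integral_box_eq_0 AE_eq_0_if_box_integrals_0 by blast

section \<open>Affine changes of variables\<close>

text \<open>
  Everything about the change of variables \<open>x \<mapsto> s x + b\<close> is read off from this form of Lebesgue measure.
\<close>

lemma lborel_scale:
  fixes b :: "real ^ 'n::finite"
  assumes "s \<noteq> 0"
  shows "lborel = density (distr lborel borel (\<lambda>x. s *\<^sub>R x + b)) (\<lambda>_. ennreal (\<bar>s\<bar> ^ CARD('n)))"
  using lborel_affine[OF assms, of b] by (simp add: add.commute)

lemma nn_integral_scale:
  fixes b :: "real ^ 'n::finite"
  assumes "s \<noteq> 0" "f \<in> borel_measurable borel"
  shows "(\<integral>\<^sup>+x. f x \<partial>lborel) = ennreal (\<bar>s\<bar> ^ CARD('n)) * (\<integral>\<^sup>+x. f (s *\<^sub>R x + b) \<partial>lborel)"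
  using assms by (subst lborel_scale[OF assms(1), of b])
    (simp add: nn_integral_density nn_integral_distr nn_integral_cmult)

lemma AE_scale:
  fixes b :: "real ^ 'n::finite"
  assumes "s \<noteq> 0" "AE x in lborel. P x"
  shows "AE x in lborel. P (s *\<^sub>R x + b)"
proof -
  obtain N where N: "{x. \<not> P x} \<subseteq> N" "N \<in> null_sets lborel"
    using assms(2) by (auto simp: eventually_ae_filter)
  then have [measurable]: "N \<in> sets borel" by auto
  have "AE x in lborel. x \<notin> N" using N(2) by (rule AE_not_in)
  then have "AE x in lborel. s *\<^sub>R x + b \<notin> N"
    by (subst (asm) lborel_scale[OF assms(1), of b])
      (simp add: AE_density AE_distr_iff assms(1))
  then show ?thesis
    by eventually_elim (use N(1) in blast)
qed

lemma integrable_scale: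
  fixes b :: "real ^ 'n::finite" and f :: "real ^ 'n \<Rightarrow> real"
  assumes "s \<noteq> 0" "integrable lborel f"
  shows "integrable lborel (\<lambda>x. f (s *\<^sub>R x + b))"
proof -
  have [measurable]: "f \<in> borel_measurable borel"
    using assms(2) by (simp add: borel_measurable_integrable)
  have "ennreal (\<bar>s\<bar> ^ CARD('n)) * (\<integral>\<^sup>+x. ennreal (norm (f (s *\<^sub>R x + b))) \<partial>lborel) < \<infinity>"
    using assms(2) nn_integral_scale[OF assms(1), of "\<lambda>x. ennreal (norm (f x))" b]
    by (simp add: integrable_iff_bounded)
  then show ?thesis
    using assms(1) by (auto simp: integrable_iff_bounded ennreal_mult_less_top)
qed

lemma affine_inverse:
  fixes b :: "real ^ 'n::finite"
  assumes "s \<noteq> 0"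
  shows "s *\<^sub>R ((1 / s) *\<^sub>R x + - ((1 / s) *\<^sub>R b)) + b = x"
    "(1 / s) *\<^sub>R (s *\<^sub>R x + b) + - ((1 / s) *\<^sub>R b) = x"
  using assms by (simp_all add: algebra_simps)

lemma integrable_scale_iff:
  fixes b :: "real ^ 'n::finite" and f :: "real ^ 'n \<Rightarrow> real"
  assumes "s \<noteq> 0"
  shows "integrable lborel (\<lambda>x. f (s *\<^sub>R x + b)) \<longleftrightarrow> integrable lborel f"
proof
  assume "integrable lborel (\<lambda>x. f (s *\<^sub>R x + b))"
  from integrable_scale[OF _ this, of "1 / s" "- ((1 / s) *\<^sub>R b)"] show "integrable lborel f"
    using assms by (simp only: affine_inverse[OF assms]) simp
qed (rule integrable_scale[OF assms])

lemma integral_scale: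
  fixes b :: "real ^ 'n::finite" and f :: "real ^ 'n \<Rightarrow> real"
  assumes "s > 0"
  shows "(LINT x|lborel. f (s *\<^sub>R x + b)) = (LINT x|lborel. f x) / s ^ CARD('n)"
proof (cases "integrable lborel f")
  case True
  have "(LINT x|lborel. f x) = s ^ CARD('n) * (LINT x|lborel. f (s *\<^sub>R x + b))"
    using assms True[THEN borel_measurable_integrable] integrable_scale[OF _ True, of s b]
    by (subst lborel_scale[of s b]) (simp_all add: integral_density integral_distr)
  then show ?thesis using assms by (simp add: field_simps)
next
  case False
  then show ?thesis
    using integrable_scale_iff[of s f b] assms by (simp add: not_integrable_integral_eq)
qed

section \<open>Test functions and weak derivatives under dilations and translations\<close>

lemma partial_scale:
  assumes "\<And>x. f differentiable (at x)"
  shows "partial i (\<lambda>x. f (r *\<^sub>R x + b)) x = r * partial i f (r *\<^sub>R x + b)"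
proof -
  have "((\<lambda>x. f (r *\<^sub>R x + b)) has_derivative
      (\<lambda>h. frechet_derivative f (at (r *\<^sub>R x + b)) (r *\<^sub>R h))) (at x)"
    by (rule has_derivative_compose[of "\<lambda>x. r *\<^sub>R x + b"])
      (auto intro!: derivative_eq_intros simp: assms frechet_derivative_works[symmetric])
  moreover have "linear (frechet_derivative f (at (r *\<^sub>R x + b)))"
    using assms by (rule linear_frechet_derivative)
  ultimately show ?thesis
    by (simp add: partial_eqI[OF _] partial_def linear_scale) (simp add: partial_eqI linear_scale partial_def[symmetric])
qed

lemma partials_scale:
  assumes "\<And>\<alpha> x. partials \<alpha> f differentiable (at x)"
  shows "partials \<alpha> (\<lambda>x. f (r *\<^sub>R x + b)) = (\<lambda>x. r ^ length \<alpha> * partials \<alpha> f (r *\<^sub>R x + b))"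
proof (induction \<alpha>)
  case (Cons i \<alpha>)
  have d: "(\<lambda>x. partials \<alpha> f (r *\<^sub>R x + b)) differentiable (at x)" for x
    by (rule differentiable_compose[of "partials \<alpha> f"]) (auto simp: assms)
  have "partial i (\<lambda>x. r ^ length \<alpha> * partials \<alpha> f (r *\<^sub>R x + b)) x
      = r ^ length \<alpha> * partial i (\<lambda>x. partials \<alpha> f (r *\<^sub>R x + b)) x" for x
    by (rule partial_eqI[THEN trans])
      (auto intro!: derivative_eq_intros d[unfolded frechet_derivative_works] simp: partial_def)
  then show ?case
    by (simp add: Cons partial_scale[OF assms] mult_ac)
qed auto

lemma test_fun_scale:
  assumes "test_fun \<phi>" "r \<noteq> 0"
  shows "test_fun (\<lambda>x. \<phi> (r *\<^sub>R x + b))"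
  unfolding test_fun_def
proof (intro conjI allI)
  have d: "partials \<alpha> \<phi> differentiable (at x)" for \<alpha> x
    using assms by (simp add: test_fun_def)
  show "partials \<alpha> (\<lambda>x. \<phi> (r *\<^sub>R x + b)) differentiable (at x)" for \<alpha> x
  proof -
    have "(\<lambda>x. partials \<alpha> \<phi> (r *\<^sub>R x + b)) differentiable (at x)"
      by (rule differentiable_compose[of "partials \<alpha> \<phi>"]) (auto simp: d)
    then show ?thesis
      by (subst partials_scale[OF d]) (intro differentiable_mult differentiable_const)
  qed
  let ?S = "closure {x. \<phi> x \<noteq> 0}"
  have "bounded {x. \<phi> (r *\<^sub>R x + b) \<noteq> 0}"
  proof (rule bounded_subset)
    show "bounded ((\<lambda>x. (1 / r) *\<^sub>R x + - ((1 / r) *\<^sub>R b)) ` ?S)"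
      using assms by (intro compact_imp_bounded compact_continuous_image continuous_intros) (simp add: test_fun_def)
    show "{x. \<phi> (r *\<^sub>R x + b) \<noteq> 0} \<subseteq> (\<lambda>x. (1 / r) *\<^sub>R x + - ((1 / r) *\<^sub>R b)) ` ?S"
    proof
      fix x assume "x \<in> {x. \<phi> (r *\<^sub>R x + b) \<noteq> 0}"
      then have "r *\<^sub>R x + b \<in> ?S" using closure_subset[of "{x. \<phi> x \<noteq> 0}"] by auto
      then show "x \<in> (\<lambda>x. (1 / r) *\<^sub>R x + - ((1 / r) *\<^sub>R b)) ` ?S"
        using affine_inverse(2)[OF assms(2), of x b] by (metis image_eqI)
    qed
  qed
  then show "compact (closure {x. \<phi> (r *\<^sub>R x + b) \<noteq> 0})"
    by (simp only: compact_closure)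
qed

lemma partial_eq_0_outside:
  assumes "x \<notin> closure {x. f x \<noteq> 0}"
  shows "partial i f x = 0"
proof -
  have "((\<lambda>x. 0) has_derivative (\<lambda>h. 0)) (at x)" by simp
  then have "(f has_derivative (\<lambda>h. 0)) (at x)"
    by (rule has_derivative_transform_within_open[of _ _ _ UNIV "- closure {x. f x \<noteq> 0}"])
      (use assms closure_subset[of "{x. f x \<noteq> 0}"] in auto)
  then show ?thesis by (rule partial_eqI)
qed

lemma test_fun_partials:
  assumes "test_fun \<phi>"
  shows "test_fun (partials \<alpha> \<phi>)"
proof (induction \<alpha>)
  case Nil
  then show ?case using assms by simp
next
  case (Cons i \<alpha>)
  let ?f = "partials \<alpha> \<phi>"
  have "{x. partial i ?f x \<noteq> 0} \<subseteq> closure {x. ?f x \<noteq> 0}"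
    using partial_eq_0_outside by blast
  then have "closure {x. partial i ?f x \<noteq> 0} \<subseteq> closure {x. ?f x \<noteq> 0}"
    by (simp add: closure_minimal)
  moreover have "partials \<beta> (partial i ?f) differentiable (at x)" for \<beta> x
    using Cons partials_append[of \<beta> "[i]" ?f] unfolding test_fun_def by (metis partials_Cons partials_Nil)
  moreover have "compact (closure {x. ?f x \<noteq> 0})"
    using Cons by (simp add: test_fun_def)
  then have "compact (closure {x. ?f x \<noteq> 0} \<inter> closure {x. partial i ?f x \<noteq> 0})"
    by (rule compact_Int_closed) simp
  ultimately show ?case
    by (simp add: test_fun_def Int_absorb1)
qed

lemma test_fun_continuous:
  assumes "test_fun \<phi>"
  shows "continuous_on UNIV \<phi>"
proof (intro continuous_at_imp_continuous_on ballI)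
  fix x
  have "partials [] \<phi> differentiable (at x)"
    using assms unfolding test_fun_def by blast
  then show "isCont \<phi> x"
    by (simp add: differentiable_imp_continuous_within)
qed

lemma integrable_times_test_fun:
  assumes "locally_integrable u" "test_fun \<phi>"
  shows "integrable lborel (\<lambda>x. u x * \<phi> x)"
proof -
  let ?S = "closure {x. \<phi> x \<noteq> 0}"
  have S: "compact ?S" using assms(2) by (simp add: test_fun_def)
  have c: "continuous_on UNIV \<phi>" by (rule test_fun_continuous[OF assms(2)])
  then have "bounded (\<phi> ` ?S)"
    using S by (meson compact_continuous_image compact_imp_bounded continuous_on_subset subset_UNIV)
  then obtain M where M: "\<And>x. x \<in> ?S \<Longrightarrow> \<bar>\<phi> x\<bar> \<le> M"
    unfolding bounded_iff by (metis imageI real_norm_def)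
  have [measurable]: "\<phi> \<in> borel_measurable borel" "u \<in> borel_measurable borel"
    using c assms(1) by (auto simp: borel_measurable_continuous_onI locally_integrable_def)
  have "set_integrable lborel ?S u" using assms(1) S by (simp add: locally_integrable_def)
  then have "integrable lborel (\<lambda>x. M * (indicator ?S x *\<^sub>R u x))"
    unfolding set_integrable_def by (rule integrable_mult_right)
  then show ?thesis
  proof (rule Bochner_Integration.integrable_bound)
    show "AE x in lborel. norm (u x * \<phi> x) \<le> norm (M * (indicator ?S x *\<^sub>R u x))"
    proof (rule AE_I2)
      fix x
      show "norm (u x * \<phi> x) \<le> norm (M * (indicator ?S x *\<^sub>R u x))"
      proof (cases "x \<in> ?S")
        case True
        then have "\<bar>u x\<bar> * \<bar>\<phi> x\<bar> \<le> \<bar>u x\<bar> * \<bar>M\<bar>"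
          using M[OF True] by (intro mult_left_mono) auto
        then show ?thesis using True by (simp add: abs_mult mult.commute)
      next
        case False
        then have "\<phi> x = 0" using closure_subset[of "{x. \<phi> x \<noteq> 0}"] by blast
        then show ?thesis by simp
      qed
    qed
    show "(\<lambda>x. u x * \<phi> x) \<in> borel_measurable lborel" by measurable
  qed
qed

lemma locally_integrable_scale:
  assumes "locally_integrable u" "s \<noteq> 0"
  shows "locally_integrable (\<lambda>x. c * u (s *\<^sub>R x + b))"
  unfolding locally_integrable_def
proof (intro conjI allI impI)
  have [measurable]: "u \<in> borel_measurable borel"
    using assms by (simp add: locally_integrable_def)
  show "(\<lambda>x. c * u (s *\<^sub>R x + b)) \<in> borel_measurable lborel" by measurable
  fix B :: "(real ^ 'a) set" assume "compact B"
  then have "compact ((\<lambda>x. s *\<^sub>R x + b) ` B)"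
    by (intro compact_continuous_image continuous_intros)
  then have "integrable lborel (\<lambda>x. indicator ((\<lambda>x. s *\<^sub>R x + b) ` B) x *\<^sub>R u x)"
    using assms(1) by (simp add: locally_integrable_def set_integrable_def)
  from integrable_scale[OF assms(2) this, of b]
  have "integrable lborel (\<lambda>x. c * (indicator ((\<lambda>x. s *\<^sub>R x + b) ` B) (s *\<^sub>R x + b) *\<^sub>R u (s *\<^sub>R x + b)))"
    by (rule integrable_mult_right)
  moreover have "indicator ((\<lambda>x. s *\<^sub>R x + b) ` B) (s *\<^sub>R x + b) = (indicator B x :: real)" for x
    using assms(2) by (simp add: indicator_def image_iff)
  ultimately show "set_integrable lborel B (\<lambda>x. c * u (s *\<^sub>R x + b))"
    by (simp add: set_integrable_def mult.left_commute)
qed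

lemma locally_integrable_add:
  "locally_integrable u \<Longrightarrow> locally_integrable v \<Longrightarrow> locally_integrable (\<lambda>x. u x + v x)"
  by (simp add: locally_integrable_def set_integral_add(1) borel_measurable_add)

lemma locally_integrable_diff:
  "locally_integrable u \<Longrightarrow> locally_integrable v \<Longrightarrow> locally_integrable (\<lambda>x. u x - v x)"
  by (simp add: locally_integrable_def set_integral_diff(1) borel_measurable_diff)

lemma locally_integrable_cong_AE:
  assumes "locally_integrable u" "v \<in> borel_measurable lborel" "AE x in lborel. u x = v x"
  shows "locally_integrable v"
  unfolding locally_integrable_def
proof (intro conjI allI impI assms(2))
  fix B :: "(real ^ 'a) set" assume "compact B"
  then have "set_integrable lborel B u" and "B \<in> sets borel"
    using assms(1) by (auto simp: locally_integrable_def compact_imp_closed)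
  moreover note assms(2)[measurable]
  ultimately show "set_integrable lborel B v"
    unfolding set_integrable_def
    by (elim integrable_cong_AE_imp) (use assms(3) in \<open>auto elim: eventually_mono\<close>)
qed

lemma weak_deriv_unique:
  assumes "weak_deriv \<alpha> u v" "weak_deriv \<alpha> u w"
  shows "AE x in lborel. v x = w x"
proof -
  have "AE x in lborel. v x - w x = 0"
  proof (rule AE_eq_0_if_orthogonal_to_test_funs)
    show "locally_integrable (\<lambda>x. v x - w x)"
      using assms by (auto simp: weak_deriv_def intro: locally_integrable_diff)
    fix \<phi> :: "real ^ 'a \<Rightarrow> real" assume "test_fun \<phi>"
    then show "(LINT x|lborel. (v x - w x) * \<phi> x) = 0"
      using assms by (simp add: weak_deriv_def left_diff_distrib integrable_times_test_fun)
  qed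
  then show ?thesis by simp
qed

lemma weak_deriv_wderiv: "weak_deriv \<alpha> u v \<Longrightarrow> weak_deriv \<alpha> u (wderiv \<alpha> u)"
  unfolding wderiv_def by (rule someI[of "weak_deriv \<alpha> u"])

lemma weak_deriv_cong_AE:
  assumes "u \<in> borel_measurable lborel" "u' \<in> borel_measurable lborel" "AE x in lborel. u x = u' x"
  shows "weak_deriv \<alpha> u = weak_deriv \<alpha> u'"
proof -
  have *: "weak_deriv \<alpha> u' v" if "weak_deriv \<alpha> u v" and m: "u' \<in> borel_measurable lborel"
    and ae: "AE x in lborel. u x = u' x" for u u' v
    unfolding weak_deriv_def
  proof (intro conjI allI impI)
    show "locally_integrable u'" "locally_integrable v"
      using that(1) locally_integrable_cong_AE[OF _ m ae] by (simp_all add: weak_deriv_def)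
    fix \<phi> :: "real ^ 'a \<Rightarrow> real" assume t: "test_fun \<phi>"
    have [measurable]: "partials \<alpha> \<phi> \<in> borel_measurable borel"
      by (intro borel_measurable_continuous_onI test_fun_continuous test_fun_partials t)
    have [measurable]: "u \<in> borel_measurable borel" "u' \<in> borel_measurable borel"
      using that(1) m by (simp_all add: weak_deriv_def locally_integrable_def)
    have "(LINT x|lborel. u' x * partials \<alpha> \<phi> x) = (LINT x|lborel. u x * partials \<alpha> \<phi> x)"
      by (rule integral_cong_AE) (use ae in \<open>auto elim: eventually_mono\<close>)
    then show "(LINT x|lborel. u' x * partials \<alpha> \<phi> x) = (- 1) ^ length \<alpha> * (LINT x|lborel. v x * \<phi> x)"
      using that t by (simp add: weak_deriv_def)
  qed
  show ?thesis
    using *[of u _ u'] *[of u' _ u] assms by (intro ext iffI) (auto simp: eq_commute)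
qed

lemma wderiv_cong_AE:
  assumes "u \<in> borel_measurable lborel" "u' \<in> borel_measurable lborel" "AE x in lborel. u x = u' x"
  shows "wderiv \<alpha> u = wderiv \<alpha> u'"
  unfolding wderiv_def weak_deriv_cong_AE[OF assms] ..

lemma weak_deriv_add:
  assumes "weak_deriv \<alpha> u v" "weak_deriv \<alpha> u' v'"
  shows "weak_deriv \<alpha> (\<lambda>x. u x + u' x) (\<lambda>x. v x + v' x)"
  unfolding weak_deriv_def
proof (intro conjI allI impI)
  show "locally_integrable (\<lambda>x. u x + u' x)" "locally_integrable (\<lambda>x. v x + v' x)"
    using assms by (auto simp: weak_deriv_def intro: locally_integrable_add)
  fix \<phi> :: "real ^ 'a \<Rightarrow> real" assume t: "test_fun \<phi>"
  have i: "integrable lborel (\<lambda>x. u x * partials \<alpha> \<phi> x)" "integrable lborel (\<lambda>x. u' x * partials \<alpha> \<phi> x)"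
    "integrable lborel (\<lambda>x. v x * \<phi> x)" "integrable lborel (\<lambda>x. v' x * \<phi> x)"
    using assms by (simp_all add: weak_deriv_def integrable_times_test_fun test_fun_partials t)
  have "(LINT x|lborel. (u x + u' x) * partials \<alpha> \<phi> x)
      = (LINT x|lborel. u x * partials \<alpha> \<phi> x) + (LINT x|lborel. u' x * partials \<alpha> \<phi> x)"
    by (simp only: distrib_right Bochner_Integration.integral_add[OF i(1,2)])
  also have "\<dots> = (- 1) ^ length \<alpha> * (LINT x|lborel. v x * \<phi> x) + (- 1) ^ length \<alpha> * (LINT x|lborel. v' x * \<phi> x)"
    using assms t by (simp add: weak_deriv_def)
  also have "\<dots> = (- 1) ^ length \<alpha> * (LINT x|lborel. (v x + v' x) * \<phi> x)"
    by (simp only: distrib_right distrib_left Bochner_Integration.integral_add[OF i(3,4)])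
  finally show "(LINT x|lborel. (u x + u' x) * partials \<alpha> \<phi> x)
      = (- 1) ^ length \<alpha> * (LINT x|lborel. (v x + v' x) * \<phi> x)" .
qed

lemma weak_deriv_zero: "weak_deriv \<alpha> (\<lambda>x. 0) (\<lambda>x. 0)"
  unfolding weak_deriv_def locally_integrable_def set_integrable_def by simp

lemma weak_deriv_sum:
  assumes "finite I" "\<And>i. i \<in> I \<Longrightarrow> weak_deriv \<alpha> (u i) (v i)"
  shows "weak_deriv \<alpha> (\<lambda>x. \<Sum>i\<in>I. u i x) (\<lambda>x. \<Sum>i\<in>I. v i x)"
  using assms
proof (induction I rule: finite_induct)
  case (insert i I)
  then have "weak_deriv \<alpha> (u i) (v i)" "weak_deriv \<alpha> (\<lambda>x. \<Sum>i\<in>I. u i x) (\<lambda>x. \<Sum>i\<in>I. v i x)"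
    by simp_all
  from weak_deriv_add[OF this] show ?case
    using insert.hyps by simp
qed (simp add: weak_deriv_zero)

text \<open>
  A weak derivative of \<open>u\<close> inherits its own weak derivatives from those of \<open>u\<close> for longer multi-indices: test the
  definition for \<open>\<alpha>\<close> against \<open>\<partial>\<^sup>\<beta> \<phi>\<close>, which is again a test function.
\<close>

lemma weak_deriv_append:
  assumes "weak_deriv \<alpha> u v" "weak_deriv (\<alpha> @ \<beta>) u w"
  shows "weak_deriv \<beta> v w"
  unfolding weak_deriv_def
proof (intro conjI allI impI)
  show "locally_integrable v" "locally_integrable w"
    using assms by (auto simp: weak_deriv_def)
  fix \<phi> :: "real ^ 'a \<Rightarrow> real" assume t: "test_fun \<phi>"
  have "(- 1) ^ length \<alpha> * (LINT x|lborel. v x * partials \<beta> \<phi> x) = (LINT x|lborel. u x * partials (\<alpha> @ \<beta>) \<phi> x)"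
    using assms(1) test_fun_partials[OF t, of \<beta>] by (simp add: weak_deriv_def partials_append)
  also have "\<dots> = (- 1) ^ length \<alpha> * ((- 1) ^ length \<beta> * (LINT x|lborel. w x * \<phi> x))"
    using assms(2) t by (simp add: weak_deriv_def power_add)
  finally show "(LINT x|lborel. v x * partials \<beta> \<phi> x) = (- 1) ^ length \<beta> * (LINT x|lborel. w x * \<phi> x)"
    by (rule mult_left_cancel[THEN iffD1, rotated]) simp
qed

text \<open>
  The substitution moves the dilation onto the test function, \<open>\<psi> (s x + b) = \<phi> x\<close>, and each derivative of \<open>\<psi>\<close>
  then contributes a factor \<open>s\<close>.
\<close>

lemma weak_deriv_scale:
  fixes u :: "real ^ 'n::finite \<Rightarrow> real"
  assumes "weak_deriv \<alpha> u v" "s > 0"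
  shows "weak_deriv \<alpha> (\<lambda>x. c * u (s *\<^sub>R x + b)) (\<lambda>x. c * s ^ length \<alpha> * v (s *\<^sub>R x + b))"
  unfolding weak_deriv_def
proof (intro conjI allI impI)
  show "locally_integrable (\<lambda>x. c * u (s *\<^sub>R x + b))" "locally_integrable (\<lambda>x. c * s ^ length \<alpha> * v (s *\<^sub>R x + b))"
    using assms by (auto simp: weak_deriv_def intro: locally_integrable_scale)
  fix \<phi> :: "real ^ 'n \<Rightarrow> real" assume t: "test_fun \<phi>"
  define \<psi> where "\<psi> = (\<lambda>x. \<phi> ((1 / s) *\<^sub>R x + - ((1 / s) *\<^sub>R b)))"
  have \<psi>: "test_fun \<psi>" unfolding \<psi>_def using assms(2) by (intro test_fun_scale t) simp
  have p: "partials \<alpha> \<phi> x = s ^ length \<alpha> * partials \<alpha> \<psi> (s *\<^sub>R x + b)" for x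
  proof -
    have "partials \<alpha> \<psi> = (\<lambda>x. (1 / s) ^ length \<alpha> * partials \<alpha> \<phi> ((1 / s) *\<^sub>R x + - ((1 / s) *\<^sub>R b)))"
      unfolding \<psi>_def by (rule partials_scale) (use t in \<open>auto simp: test_fun_def\<close>)
    then show ?thesis
      using assms(2) affine_inverse(2)[of s x b] by (simp add: power_one_over field_simps)
  qed
  have \<phi>: "\<phi> x = \<psi> (s *\<^sub>R x + b)" for x
    unfolding \<psi>_def using affine_inverse(2)[of s x b] assms(2) by simp
  have "(LINT x|lborel. c * u (s *\<^sub>R x + b) * partials \<alpha> \<phi> x)
      = c * s ^ length \<alpha> * (LINT x|lborel. u (s *\<^sub>R x + b) * partials \<alpha> \<psi> (s *\<^sub>R x + b))"
  proof -
    have "c * u (s *\<^sub>R x + b) * partials \<alpha> \<phi> x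
        = (c * s ^ length \<alpha>) * (u (s *\<^sub>R x + b) * partials \<alpha> \<psi> (s *\<^sub>R x + b))" for x
      unfolding p by (simp only: mult_ac)
    then show ?thesis by (simp only: integral_mult_right_zero)
  qed
  also have "\<dots> = c * s ^ length \<alpha> * ((LINT x|lborel. u x * partials \<alpha> \<psi> x) / s ^ CARD('n))"
    using integral_scale[OF assms(2), of "\<lambda>x. u x * partials \<alpha> \<psi> x" b] by simp
  also have "\<dots> = (- 1) ^ length \<alpha> * (c * s ^ length \<alpha> * ((LINT x|lborel. v x * \<psi> x) / s ^ CARD('n)))"
    using assms(1) \<psi> by (simp add: weak_deriv_def)
  also have "\<dots> = (- 1) ^ length \<alpha> * (c * s ^ length \<alpha> * (LINT x|lborel. v (s *\<^sub>R x + b) * \<psi> (s *\<^sub>R x + b)))"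
    using integral_scale[OF assms(2), of "\<lambda>x. v x * \<psi> x" b] by simp
  also have "\<dots> = (- 1) ^ length \<alpha> * (LINT x|lborel. c * s ^ length \<alpha> * v (s *\<^sub>R x + b) * \<phi> x)"
  proof -
    have "c * s ^ length \<alpha> * v (s *\<^sub>R x + b) * \<phi> x
        = (c * s ^ length \<alpha>) * (v (s *\<^sub>R x + b) * \<psi> (s *\<^sub>R x + b))" for x
      unfolding \<phi> by (simp only: mult_ac)
    then show ?thesis by (simp only: integral_mult_right_zero)
  qed
  finally show "(LINT x|lborel. c * u (s *\<^sub>R x + b) * partials \<alpha> \<phi> x)
      = (- 1) ^ length \<alpha> * (LINT x|lborel. c * s ^ length \<alpha> * v (s *\<^sub>R x + b) * \<phi> x)" .
qed

lemma wderiv_scale: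
  assumes "weak_deriv \<alpha> u v" "s > 0"
  shows "AE x in lborel. wderiv \<alpha> (\<lambda>x. c * u (s *\<^sub>R x + b)) x = c * s ^ length \<alpha> * wderiv \<alpha> u (s *\<^sub>R x + b)"
proof (rule weak_deriv_unique)
  show *: "weak_deriv \<alpha> (\<lambda>x. c * u (s *\<^sub>R x + b)) (\<lambda>x. c * s ^ length \<alpha> * wderiv \<alpha> u (s *\<^sub>R x + b))"
    by (rule weak_deriv_scale[OF weak_deriv_wderiv[OF assms(1)] assms(2)])
  show "weak_deriv \<alpha> (\<lambda>x. c * u (s *\<^sub>R x + b)) (wderiv \<alpha> (\<lambda>x. c * u (s *\<^sub>R x + b)))"
    by (rule weak_deriv_wderiv[OF *])
qed

section \<open>Iterated weak Laplacians\<close>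

text \<open>
  Existence of the weak derivatives up to order \<open>k\<close>, without integrability beyond the local one. This is
  what survives an application of the weak Laplacian, at the cost of two orders.
\<close>

definition has_weak_derivs :: "nat \<Rightarrow> (real ^ 'n::finite \<Rightarrow> real) \<Rightarrow> bool" where
  "has_weak_derivs k u \<longleftrightarrow> (\<forall>\<alpha>. length \<alpha> \<le> k \<longrightarrow> (\<exists>v. weak_deriv \<alpha> u v))"

lemma has_weak_derivs_mono: "has_weak_derivs k u \<Longrightarrow> j \<le> k \<Longrightarrow> has_weak_derivs j u"
  by (auto simp: has_weak_derivs_def)

lemma has_weak_derivs_measurable:
  assumes "has_weak_derivs k u"
  shows "u \<in> borel_measurable lborel"
proof -
  have "\<exists>v. weak_deriv [] u v"
    by (intro assms[unfolded has_weak_derivs_def, rule_format]) simp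
  then show ?thesis
    unfolding weak_deriv_def locally_integrable_def by blast
qed

lemma has_weak_derivs_scale:
  "has_weak_derivs k u \<Longrightarrow> s > 0 \<Longrightarrow> has_weak_derivs k (\<lambda>x. c * u (s *\<^sub>R x + b))"
  unfolding has_weak_derivs_def using weak_deriv_scale by blast

lemma has_weak_derivs_wlaplacian:
  assumes "has_weak_derivs (k + 2) u"
  shows "has_weak_derivs k (wlaplacian u)"
  unfolding has_weak_derivs_def
proof (intro allI impI)
  fix \<alpha> :: "'a list" assume l: "length \<alpha> \<le> k"
  have "\<exists>v. weak_deriv ([i, i] @ \<alpha>) u v" for i
    using l by (intro assms[unfolded has_weak_derivs_def, rule_format]) simp
  then obtain w where w: "\<And>i. weak_deriv ([i, i] @ \<alpha>) u (w i)" by metis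
  have "\<exists>v. weak_deriv [i, i] u v" for i
    by (intro assms[unfolded has_weak_derivs_def, rule_format]) simp
  then have "weak_deriv [i, i] u (wderiv [i, i] u)" for i
    using weak_deriv_wderiv by blast
  then have "weak_deriv \<alpha> (wderiv [i, i] u) (w i)" for i
    using weak_deriv_append w by blast
  then have "weak_deriv \<alpha> (\<lambda>x. \<Sum>i\<in>UNIV. wderiv [i, i] u x) (\<lambda>x. \<Sum>i\<in>UNIV. w i x)"
    by (intro weak_deriv_sum) auto
  then show "\<exists>v. weak_deriv \<alpha> (wlaplacian u) v"
    unfolding wlaplacian_def[abs_def] by blast
qed

lemma has_weak_derivs_wlaplacian_iter:
  "has_weak_derivs (k + 2 * j) u \<Longrightarrow> has_weak_derivs k ((wlaplacian ^^ j) u)"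
proof (induction j arbitrary: k)
  case (Suc j)
  from Suc.prems have "has_weak_derivs ((k + 2) + 2 * j) u" by simp
  then have "has_weak_derivs (k + 2) ((wlaplacian ^^ j) u)" by (rule Suc.IH)
  then show ?case by (simp only: funpow.simps comp_apply has_weak_derivs_wlaplacian)
qed simp

lemma wlaplacian_scale:
  assumes "has_weak_derivs 2 u" "s > 0"
  shows "AE x in lborel. wlaplacian (\<lambda>x. c * u (s *\<^sub>R x + b)) x = c * s ^ 2 * wlaplacian u (s *\<^sub>R x + b)"
proof -
  have "AE x in lborel. wderiv [i, i] (\<lambda>x. c * u (s *\<^sub>R x + b)) x = c * s ^ 2 * wderiv [i, i] u (s *\<^sub>R x + b)" for i
  proof -
    obtain v where "weak_deriv [i, i] u v"
      using assms(1)[unfolded has_weak_derivs_def, rule_format, of "[i, i]"] by auto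
    from wderiv_scale[OF this assms(2), of c b] show ?thesis by (simp add: power2_eq_square)
  qed
  then have "AE x in lborel. \<forall>i\<in>UNIV. wderiv [i, i] (\<lambda>x. c * u (s *\<^sub>R x + b)) x = c * s ^ 2 * wderiv [i, i] u (s *\<^sub>R x + b)"
    by (simp add: AE_all_countable)
  then show ?thesis
    by eventually_elim (simp add: wlaplacian_def sum_distrib_left)
qed

text \<open>
  The two sides agree only almost everywhere, whereas the next Laplacian is applied to a function: this
  is harmless because \<open>wderiv\<close> takes the same value on functions that agree almost everywhere.
\<close>

lemma wlaplacian_iter_scale:
  assumes "has_weak_derivs (2 * j) u" "s > 0"
  shows "AE x in lborel. (wlaplacian ^^ j) (\<lambda>x. c * u (s *\<^sub>R x + b)) x
    = c * s ^ (2 * j) * (wlaplacian ^^ j) u (s *\<^sub>R x + b)"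
  using assms(1)
proof (induction j)
  case (Suc j)
  let ?T = "\<lambda>x. c * u (s *\<^sub>R x + b)" and ?L = "(wlaplacian ^^ j) u"
  have L: "has_weak_derivs 2 ?L"
    using Suc.prems by (intro has_weak_derivs_wlaplacian_iter) simp
  have T: "has_weak_derivs 2 ((wlaplacian ^^ j) ?T)"
    using Suc.prems assms(2) by (intro has_weak_derivs_wlaplacian_iter has_weak_derivs_scale) simp_all
  have "AE x in lborel. (wlaplacian ^^ j) ?T x = (c * s ^ (2 * j)) * ?L (s *\<^sub>R x + b)"
    using Suc.prems by (intro Suc.IH has_weak_derivs_mono[OF Suc.prems]) simp
  then have "wderiv \<alpha> ((wlaplacian ^^ j) ?T) = wderiv \<alpha> (\<lambda>x. (c * s ^ (2 * j)) * ?L (s *\<^sub>R x + b))" for \<alpha>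
    by (rule wderiv_cong_AE[rotated 2])
      (use has_weak_derivs_measurable[OF T] has_weak_derivs_measurable[OF has_weak_derivs_scale[OF L assms(2)]] in auto)
  then have "wlaplacian ((wlaplacian ^^ j) ?T) = wlaplacian (\<lambda>x. (c * s ^ (2 * j)) * ?L (s *\<^sub>R x + b))"
    by (simp add: wlaplacian_def[abs_def])
  moreover have "AE x in lborel. wlaplacian (\<lambda>x. (c * s ^ (2 * j)) * ?L (s *\<^sub>R x + b)) x
      = (c * s ^ (2 * j)) * s ^ 2 * wlaplacian ?L (s *\<^sub>R x + b)"
    by (rule wlaplacian_scale[OF L assms(2)])
  ultimately show ?case
    by (simp add: mult_ac power2_eq_square)
qed simp

lemma nabla_inner_scale:
  assumes "has_weak_derivs m u" "s > 0"
  shows "AE x in lborel. nabla_inner m (\<lambda>x. c * u (s *\<^sub>R x + b)) (\<lambda>x. c * u (s *\<^sub>R x + b)) x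
    = c\<^sup>2 * s ^ (2 * m) * nabla_inner m u u (s *\<^sub>R x + b)"
proof (cases "even m")
  case True
  then obtain j where j: "m = 2 * j" by blast
  have "AE x in lborel. (wlaplacian ^^ j) (\<lambda>x. c * u (s *\<^sub>R x + b)) x = c * s ^ m * (wlaplacian ^^ j) u (s *\<^sub>R x + b)"
    using wlaplacian_iter_scale[of j u s c b] assms j by simp
  then show ?thesis
    by eventually_elim (simp add: nabla_inner_def j power2_eq_square mult_2 power_add)
next
  case False
  then obtain j where j: "m = 2 * j + 1" by (rule oddE)
  let ?T = "\<lambda>x. c * u (s *\<^sub>R x + b)" and ?L = "(wlaplacian ^^ j) u"
  have L: "has_weak_derivs 1 ?L"
    using assms j by (intro has_weak_derivs_wlaplacian_iter) simp
  have T: "has_weak_derivs 1 ((wlaplacian ^^ j) ?T)"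
    using assms j by (intro has_weak_derivs_wlaplacian_iter has_weak_derivs_scale) simp_all
  have "AE x in lborel. (wlaplacian ^^ j) ?T x = (c * s ^ (2 * j)) * ?L (s *\<^sub>R x + b)"
    using assms j by (intro wlaplacian_iter_scale has_weak_derivs_mono[OF assms(1)]) simp_all
  then have w: "wderiv \<alpha> ((wlaplacian ^^ j) ?T) = wderiv \<alpha> (\<lambda>x. (c * s ^ (2 * j)) * ?L (s *\<^sub>R x + b))" for \<alpha>
    by (rule wderiv_cong_AE[rotated 2])
      (use has_weak_derivs_measurable[OF T] has_weak_derivs_measurable[OF has_weak_derivs_scale[OF L assms(2)]] in auto)
  have "AE x in lborel. wderiv [i] ((wlaplacian ^^ j) ?T) x = c * s ^ m * wderiv [i] ?L (s *\<^sub>R x + b)" for i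
  proof -
    obtain v where "weak_deriv [i] ?L v"
      using L[unfolded has_weak_derivs_def, rule_format, of "[i]"] by auto
    from wderiv_scale[OF this assms(2), of "c * s ^ (2 * j)" b] show ?thesis
      by (simp add: w j mult_ac)
  qed
  then have "AE x in lborel. \<forall>i\<in>UNIV. wderiv [i] ((wlaplacian ^^ j) ?T) x = c * s ^ m * wderiv [i] ?L (s *\<^sub>R x + b)"
    by (simp add: AE_all_countable)
  then have "AE x in lborel. wgrad ((wlaplacian ^^ j) ?T) x = (c * s ^ m) *\<^sub>R wgrad ?L (s *\<^sub>R x + b)"
    by eventually_elim (simp add: wgrad_def vec_eq_iff)
  then show ?thesis
    by eventually_elim (simp add: nabla_inner_def j power2_eq_square mult_2 power_add)
qed

lemma sobolev_has_weak_derivs: "u \<in> sobolev m \<Longrightarrow> has_weak_derivs m u"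
  by (auto simp: sobolev_def has_weak_derivs_def)

lemma L2_scale:
  assumes "u \<in> L2" "s \<noteq> 0"
  shows "(\<lambda>x. c * u (s *\<^sub>R x + b)) \<in> L2"
proof -
  have [measurable]: "u \<in> borel_measurable borel" using assms by (simp add: L2_def)
  show ?thesis
    using assms integrable_scale[OF assms(2), of "\<lambda>x. (u x)\<^sup>2" b]
    by (simp add: L2_def power_mult_distrib)
qed

lemma sobolev_scale:
  assumes "u \<in> sobolev m" "s > 0"
  shows "(\<lambda>x. c * u (s *\<^sub>R x + b)) \<in> sobolev m"
  using assms L2_scale[of _ s] weak_deriv_scale[OF _ assms(2)] unfolding sobolev_def by blast

lemma nabla_inner_nonneg: "0 \<le> nabla_inner m u u x"
  by (simp add: nabla_inner_def)

lemma nabla_inner_measurable: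
  assumes "has_weak_derivs m u"
  shows "nabla_inner m u u \<in> borel_measurable borel"
proof (cases "even m")
  case True
  then obtain j where j: "m = 2 * j" by blast
  have "has_weak_derivs 0 ((wlaplacian ^^ j) u)"
    using assms j by (intro has_weak_derivs_wlaplacian_iter) simp
  then have [measurable]: "(wlaplacian ^^ j) u \<in> borel_measurable borel"
    using has_weak_derivs_measurable by auto
  show ?thesis by (simp add: nabla_inner_def[abs_def] j)
next
  case False
  then obtain j where j: "m = 2 * j + 1" by (rule oddE)
  let ?L = "(wlaplacian ^^ j) u"
  have L: "has_weak_derivs 1 ?L"
    using assms j by (intro has_weak_derivs_wlaplacian_iter) simp
  have [measurable]: "wderiv [i] ?L \<in> borel_measurable borel" for i
  proof -
    obtain v where "weak_deriv [i] ?L v"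
      using L[unfolded has_weak_derivs_def, rule_format, of "[i]"] by auto
    from weak_deriv_wderiv[OF this] show ?thesis
      by (simp add: weak_deriv_def locally_integrable_def)
  qed
  show ?thesis by (simp add: nabla_inner_def[abs_def] j wgrad_def inner_vec_def)
qed

section \<open>The nonlinearity along dilations\<close>

lemma G_of_has_derivative:
  assumes "continuous_on UNIV g"
  shows "(G_of g has_real_derivative g s) (at s)"
proof -
  let ?I = "{- \<bar>s\<bar> - 1..\<bar>s\<bar> + 1}"
  have "((\<lambda>u. LBINT y=ereal 0..ereal u. g y) has_vector_derivative g s) (at s within ?I)"
    by (rule interval_integral_FTC2) (use assms in \<open>auto intro: continuous_on_subset\<close>)
  moreover have "at s within ?I = at s"
    by (rule at_within_interior) auto
  ultimately show ?thesis
    by (simp add: has_real_derivative_iff_has_vector_derivative G_of_def[abs_def] zero_ereal_def)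
qed

lemma H_of_has_derivative:
  assumes "A0 N m g"
  shows "(H_of g has_real_derivative h_of g s) (at s)"
  using assms by (simp add: A0_def h_of_def DERIV_deriv_iff_field_differentiable)

text \<open>
  By (A4), \<open>r \<mapsto> r\<^sup>-\<^sup>p H (r a)\<close> with the mass-critical exponent \<open>p\<close> has a nonnegative derivative on \<open>r > 0\<close>,
  whatever the sign of \<open>a\<close>.
\<close>

lemma H_of_scale_le:
  assumes "A0 N m g" "A4 N m g" "0 < r" "r \<le> 1"
  shows "H_of g (r * a) \<le> r powr mass_exp N m * H_of g a"
proof -
  let ?p = "mass_exp N m"
  let ?f = "\<lambda>r. H_of g (r * a) * r powr (- ?p)"
  have "?f r \<le> ?f 1"
  proof (rule DERIV_nonneg_imp_nondecreasing[of r 1 ?f])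
    fix x assume "r \<le> x" "x \<le> 1"
    then have x: "x > 0" using assms(3) by simp
    have "(?f has_real_derivative h_of g (x * a) * a * x powr (- ?p) + H_of g (x * a) * (- ?p * x powr (- ?p - 1))) (at x)"
      using x by (auto intro!: derivative_eq_intros DERIV_chain2[OF H_of_has_derivative[OF assms(1)]])
    moreover have "h_of g (x * a) * a * x powr (- ?p) + H_of g (x * a) * (- ?p * x powr (- ?p - 1))
        = x powr (- ?p - 1) * (h_of g (x * a) * (x * a) - ?p * H_of g (x * a))"
      using x by (simp add: powr_diff field_simps)
    moreover have "?p * H_of g (x * a) \<le> h_of g (x * a) * (x * a)"
      using assms(2) by (simp add: A4_def prec_le_def)
    ultimately show "\<exists>y. (?f has_real_derivative y) (at x) \<and> 0 \<le> y"
      by (intro exI[of _ "x powr (- ?p - 1) * (h_of g (x * a) * (x * a) - ?p * H_of g (x * a))"] conjI) simp_all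
  qed (use assms in auto)
  then show ?thesis
    using assms(3) by (simp add: powr_minus field_simps)
qed

lemma G_H_bounds:
  assumes "A5 N m g" "N > 0" "m > 0"
  shows "0 \<le> G_of g s" "4 * real m / real N * G_of g s \<le> H_of g s" "0 \<le> H_of g s"
proof -
  have "0 \<le> 4 * real m / real N * G_of g s"
    using assms(1) by (simp add: A5_def prec_le_def)
  then show 0: "0 \<le> G_of g s"
    using assms(2,3) by (auto simp: zero_le_mult_iff zero_le_divide_iff)
  show 1: "4 * real m / real N * G_of g s \<le> H_of g s"
    using assms(1) by (simp add: A5_def)
  have "0 \<le> 4 * real m / real N * G_of g s" using 0 by simp
  with 1 show "0 \<le> H_of g s" by linarith
qed

text \<open>
  The dilation \<open>s\<^sup>N\<^sup>/\<^sup>2 u (s x)\<close> preserves the \<open>L\<^sup>2\<close>-norm, and along it the energy is largest on the constraint. This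
  is the pointwise form of that fact: \<open>s\<^sup>-\<^sup>N G (s\<^sup>N\<^sup>/\<^sup>2 a)\<close> has the derivative \<open>(N / 2) s\<^sup>-\<^sup>N\<^sup>-\<^sup>1 H (s\<^sup>N\<^sup>/\<^sup>2 a)\<close>, which is at most
  \<open>(N / 2) s\<^sup>2\<^sup>m\<^sup>-\<^sup>1 H a\<close> for \<open>s \<le> 1\<close> by \<open>H_of_scale_le\<close>. Having it pointwise avoids differentiating integrals.
\<close>

lemma fiber_energy_le:
  assumes "A0 N m g" "A4 N m g" "N > 0" "m > 0" "0 < s" "s \<le> 1"
  shows "G_of g a - G_of g (s powr (N / 2) * a) / s ^ N \<le> N / (4 * m) * (1 - s ^ (2 * m)) * H_of g a"
proof -
  let ?D = "\<lambda>s. G_of g (s powr (N / 2) * a) * s powr (- real N) - N / (4 * m) * s powr (2 * real m) * H_of g a"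
  have g: "continuous_on UNIV g" using assms(1) by (simp add: A0_def)
  have "?D 1 \<le> ?D s"
  proof (rule DERIV_nonpos_imp_nonincreasing[of s 1 ?D])
    fix x assume "s \<le> x" "x \<le> 1"
    then have x: "x > 0" using assms by simp
    let ?t = "x powr (N / 2) * a"
    let ?d = "g ?t * (N / 2 * x powr (N / 2 - 1) * a) * x powr (- real N)
        + G_of g ?t * (- real N * x powr (- real N - 1)) - N / (4 * m) * (2 * real m * x powr (2 * real m - 1)) * H_of g a"
    have "(?D has_real_derivative ?d) (at x)"
      using x by (auto intro!: derivative_eq_intros DERIV_chain2[OF G_of_has_derivative[OF g]])
    moreover have "?d = N / 2 * x powr (- real N - 1) * (H_of g ?t - x powr (N + 2 * real m) * H_of g a)"
    proof -
      have "x powr (- real N - 1) * x powr (N + 2 * real m) = x powr (2 * real m - 1)"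
        by (simp flip: powr_add)
      moreover have "g ?t * (N / 2 * x powr (N / 2 - 1) * a) * x powr (- real N) = N / 2 * x powr (- real N - 1) * (g ?t * ?t)"
      proof -
        have "x powr (N / 2 - 1) * x powr (- real N) = x powr (- real N - 1) * x powr (N / 2)"
          by (simp flip: powr_add)
        then have "g ?t * (N / 2) * a * (x powr (N / 2 - 1) * x powr (- real N))
            = g ?t * (N / 2) * a * (x powr (- real N - 1) * x powr (N / 2))" by simp
        then show ?thesis by (simp only: mult_ac)
      qed
      moreover have "N / (4 * m) * (2 * real m * X) * H_of g a = N / 2 * X * H_of g a" for X
        using assms(4) by simp
      moreover have "real N / 2 * E * p + q * (- real N * E) - real N / 2 * (E * T) * h
          = real N / 2 * E * ((p - 2 * q) - T * h)" for E T p q h :: real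
        by (simp add: algebra_simps)
      ultimately show ?thesis
        by (simp only: H_of_def) metis
    qed
    moreover have H: "H_of g ?t \<le> x powr (N + 2 * real m) * H_of g a"
    proof -
      have "H_of g ?t \<le> (x powr (N / 2)) powr mass_exp N m * H_of g a"
        using x \<open>x \<le> 1\<close> by (intro H_of_scale_le assms) (auto intro: powr_le1)
      moreover have "N / 2 * mass_exp N m = N + 2 * real m"
        using assms(3) by (simp add: mass_exp_def field_simps)
      ultimately show ?thesis by (simp only: powr_powr)
    qed
    moreover have "N / 2 * x powr (- real N - 1) * (H_of g ?t - x powr (N + 2 * real m) * H_of g a) \<le> 0"
      using H by (intro mult_nonneg_nonpos) auto
    ultimately show "\<exists>y. (?D has_real_derivative y) (at x) \<and> y \<le> 0"
      by (intro exI[of _ ?d] conjI) (assumption, simp only:)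
  qed (use assms in auto)
  moreover have "s powr (- real N) = 1 / s ^ N" "s powr (2 * real m) = s ^ (2 * m)"
    using assms powr_realpow[of s "2 * m"] by (simp_all add: powr_minus powr_realpow divide_inverse)
  ultimately show ?thesis
    by (simp add: algebra_simps diff_divide_distrib)
qed

lemma eta_real:
  assumes "A1 N m g" "A5 N m g" "N > 0" "m > 0"
  obtains e where "eta N m g = ereal e" "0 \<le> e"
proof -
  have "0 \<le> eta N m g"
    unfolding eta_def
    by (intro order_trans[OF Liminf_bounded Liminf_le_Limsup])
      (use G_H_bounds[OF assms(2-4)] in auto)
  moreover have "eta N m g < \<infinity>" using assms(1) by (simp add: A1_def)
  ultimately show ?thesis
    using that by (cases "eta N m g") auto
qed

lemma H_of_le_near_0:
  assumes "eta N m g = ereal e" "e < e'"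
  obtains d where "d > 0" "\<And>t. \<bar>t\<bar> < d \<Longrightarrow> H_of g t \<le> e' * \<bar>t\<bar> powr mass_exp N m"
proof -
  have "eta N m g < ereal e'" using assms by simp
  then have "\<forall>\<^sub>F t in at 0. ereal (H_of g t / \<bar>t\<bar> powr mass_exp N m) < ereal e'"
    unfolding eta_def by (rule Limsup_lessD)
  then obtain d where d: "d > 0" "\<And>t. t \<noteq> 0 \<Longrightarrow> dist t 0 < d \<Longrightarrow> H_of g t / \<bar>t\<bar> powr mass_exp N m < e'"
    by (auto simp: eventually_at)
  have "H_of g t \<le> e' * \<bar>t\<bar> powr mass_exp N m" if "\<bar>t\<bar> < d" for t
  proof (cases "t = 0")
    case True
    then show ?thesis by (simp add: H_of_def G_of_def flip: zero_ereal_def)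
  next
    case False
    then show ?thesis using d(2)[of t] that by (simp add: divide_less_eq split: if_splits)
  qed
  with d(1) show ?thesis using that by blast
qed

section \<open>Averaging the singular potential over translations\<close>

lemma nn_integral_prod_cart:
  fixes f :: "'n::finite \<Rightarrow> real \<Rightarrow> ennreal"
  assumes [measurable]: "\<And>i. f i \<in> borel_measurable borel"
  shows "(\<integral>\<^sup>+x. (\<Prod>i\<in>UNIV. f i (x $ i)) \<partial>(lborel :: (real ^ 'n) measure)) = (\<Prod>i\<in>UNIV. \<integral>\<^sup>+t. f i t \<partial>lborel)"
proof -
  let ?e = "\<lambda>i::'n. axis i (1::real)"
  have inj: "inj ?e" by (auto simp: inj_on_def axis_eq_axis)
  have B: "(Basis :: (real ^ 'n) set) = range ?e" by (auto simp: Basis_vec_def)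
  let ?F = "\<lambda>b. f (inv ?e b)"
  have "(\<integral>\<^sup>+x. (\<Prod>b\<in>Basis. ?F b (x \<bullet> b)) \<partial>(lborel :: (real ^ 'n) measure)) = (\<Prod>b\<in>Basis. \<integral>\<^sup>+t. ?F b t \<partial>lborel)"
    by (rule nn_integral_lborel_prod) auto
  then show ?thesis
    unfolding B by (simp add: prod.reindex[OF inj] inv_f_f[OF inj] inner_axis)
qed

lemma AE_coordinates_nonzero: "AE x in (lborel :: (real ^ 'n::finite) measure). \<forall>i. x $ i \<noteq> 0"
proof -
  have "AE x in (lborel :: (real ^ 'n) measure). x $ i \<noteq> 0" for i
  proof -
    have "{x :: real ^ 'n. x $ i = 0} \<in> null_sets lebesgue"
      using negligible_standard_hyperplane_cart[of i] by (simp add: negligible_iff_null_sets)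
    moreover have "{x :: real ^ 'n. x $ i = 0} \<in> sets borel"
      by (intro borel_closed closed_Collect_eq continuous_intros)
    ultimately have "{x :: real ^ 'n. x $ i = 0} \<in> null_sets lborel"
      by (simp add: null_sets_def)
    from AE_not_in[OF this] show ?thesis by simp
  qed
  then show ?thesis by (simp add: AE_all_countable)
qed

lemma unit_interval_powr_bound:
  assumes "0 \<le> a" "a < 1"
  obtains A where "A \<ge> 1"
    "\<And>x. (\<integral>\<^sup>+t. ennreal (\<bar>t\<bar> powr (- a)) * indicator {x..x+1} t \<partial>lborel) \<le> ennreal A"
proof -
  let ?f = "\<lambda>t. indicator {0..1} t * t powr (- a) :: real"
  let ?c = "1 powr (- a + 1) / (- a + 1) :: real"
  have "((\<lambda>t. t powr (- a)) has_integral ?c) {0..1}"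
    using assms by (intro has_integral_powr_from_0) auto
  then have "((\<lambda>t. if t \<in> {0..1} then t powr (- a) else 0) has_integral ?c) UNIV"
    by (simp only: has_integral_restrict_UNIV)
  also have "(\<lambda>t. if t \<in> {0..1} then t powr (- a) else 0) = ?f"
    by (auto simp: indicator_def)
  finally have f: "(\<integral>\<^sup>+t. ennreal (?f t) \<partial>lborel) = ennreal ?c"
    by (intro nn_integral_has_integral_lborel) auto
  then have f': "(\<integral>\<^sup>+t. ennreal (?f (- t)) \<partial>lborel) = ennreal ?c"
    using nn_integral_real_affine[of "\<lambda>t. ennreal (?f t)" "-1" 0] by simp
  have c: "?c \<ge> 0" using assms by simp
  have "(\<integral>\<^sup>+t. ennreal (\<bar>t\<bar> powr (- a)) * indicator {x..x+1} t \<partial>lborel) \<le> ennreal (?c + ?c + 1)" for x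
  proof -
    have "(\<integral>\<^sup>+t. ennreal (\<bar>t\<bar> powr (- a)) * indicator {x..x+1} t \<partial>lborel)
        \<le> (\<integral>\<^sup>+t. ennreal (?f t) + ennreal (?f (- t)) + indicator {x..x+1} t \<partial>lborel)"
    proof (rule nn_integral_mono)
      fix t :: real
      have "\<bar>t\<bar> powr (- a) \<le> ?f t + ?f (- t) + 1"
      proof (cases "\<bar>t\<bar> \<le> 1")
        case False
        then have "\<bar>t\<bar> powr (- a) \<le> \<bar>t\<bar> powr 0"
          using assms by (intro powr_mono) auto
        also have "\<dots> \<le> ?f t + ?f (- t) + 1" by simp
        finally show ?thesis .
      qed (auto simp: indicator_def)
      then have "ennreal (\<bar>t\<bar> powr (- a)) \<le> ennreal (?f t + ?f (- t) + 1)"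
        by (rule ennreal_leI)
      also have "\<dots> = ennreal (?f t) + ennreal (?f (- t)) + 1"
        by (simp add: ennreal_plus)
      finally show "ennreal (\<bar>t\<bar> powr (- a)) * indicator {x..x+1} t \<le> ennreal (?f t) + ennreal (?f (- t)) + indicator {x..x+1} t"
        by (cases "t \<in> {x..x+1}") simp_all
    qed
    also have "\<dots> = ennreal ?c + ennreal ?c + ennreal 1"
      by (subst nn_integral_add, simp, simp, subst nn_integral_add, simp, simp, simp only: f f', simp)
    also have "\<dots> = ennreal (?c + ?c + 1)"
      using c by (simp only: ennreal_plus add_nonneg_nonneg zero_le_one)
    finally show ?thesis .
  qed
  then show ?thesis using that[of "?c + ?c + 1"] c by simp
qed

lemma hardy_weight_nonneg: "0 \<le> \<mu> \<Longrightarrow> 0 \<le> hardy_weight m \<mu> Y x"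
  by (simp add: hardy_weight_def L2_set_nonneg)

lemma hardy_weight_measurable [measurable]: "hardy_weight m \<mu> Y \<in> borel_measurable borel"
  unfolding hardy_weight_def[abs_def] L2_set_def by measurable

lemma hardy_weight_scaleR:
  assumes "r > 0"
  shows "hardy_weight m \<mu> Y (r *\<^sub>R x) = hardy_weight m \<mu> Y x / r ^ (2 * m)"
  using assms by (simp add: hardy_weight_def L2_set_right_distrib[symmetric] power_mult_distrib)

text \<open>
  Each \<open>|x\<^sub>i|\<close> with \<open>i \<in> Y\<close> is at most \<open>|y|\<close>, so the \<open>card Y\<close>-th part of the singularity can be charged to each of
  these coordinates. The resulting power \<open>2 m / card Y\<close> is less than \<open>1\<close>, hence integrable in one dimension.
  On the coordinate hyperplanes the product is zero by the convention for \<open>powr\<close>, hence the hypothesis on \<open>x\<close>.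
\<close>

lemma hardy_weight_le_prod:
  assumes "0 \<le> \<mu>" "Y \<noteq> {}" "\<And>i. x $ i \<noteq> 0"
  shows "hardy_weight m \<mu> Y x \<le> \<mu> * (\<Prod>i\<in>Y. \<bar>x $ i\<bar> powr (- (2 * real m / real (card Y))))"
proof -
  let ?a = "2 * real m / real (card Y)" and ?L = "L2_set (\<lambda>i. x $ i) Y"
  have le: "\<bar>x $ i\<bar> \<le> ?L" if "i \<in> Y" for i
    using member_le_L2_set[of Y i "\<lambda>i. \<bar>x $ i\<bar>"] that by (simp add: L2_set_def)
  obtain j where "j \<in> Y" using assms(2) by blast
  then have L: "?L > 0" using le[of j] assms(3)[of j] by simp
  have K: "card Y > 0" using assms(2) by (simp add: card_gt_0_iff)
  have "?L powr (- (2 * real m)) = (\<Prod>i\<in>Y. ?L powr (- ?a))"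
    using L K by (simp add: powr_power)
  also have "\<dots> \<le> (\<Prod>i\<in>Y. \<bar>x $ i\<bar> powr (- ?a))"
    using le assms(3) by (intro prod_mono conjI powr_mono2') auto
  finally have "?L powr (- (2 * real m)) \<le> (\<Prod>i\<in>Y. \<bar>x $ i\<bar> powr (- ?a))" .
  moreover have "?L powr (- (2 * real m)) = 1 / ?L ^ (2 * m)"
    using L powr_realpow[of ?L "2 * m"] by (simp add: powr_minus divide_inverse)
  ultimately have "\<mu> * (1 / ?L ^ (2 * m)) \<le> \<mu> * (\<Prod>i\<in>Y. \<bar>x $ i\<bar> powr (- ?a))"
    using assms(1) by (intro mult_left_mono) simp_all
  then show ?thesis by (simp add: hardy_weight_def)
qed

text \<open>
  The indicator function of the unit cube, as a product to which Tonelli's theorem applies factor by factor.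
\<close>

definition unit_cube_weight :: "real ^ 'n::finite \<Rightarrow> ennreal" where
  "unit_cube_weight \<sigma> = (\<Prod>i\<in>UNIV. indicator {0..1} (\<sigma> $ i))"

lemma unit_cube_weight_measurable [measurable]: "unit_cube_weight \<in> borel_measurable borel"
  unfolding unit_cube_weight_def[abs_def] by measurable

lemma nn_integral_unit_cube: "(\<integral>\<^sup>+\<sigma>. unit_cube_weight (\<sigma> :: real ^ 'n::finite) \<partial>lborel) = 1"
  unfolding unit_cube_weight_def by (subst nn_integral_prod_cart) auto

lemma hardy_unit_cube_bound:
  fixes Y :: "'n::finite set"
  assumes "2 * m < card Y" "0 \<le> \<mu>"
  obtains M where "0 \<le> M"
    "\<And>x :: real ^ 'n. (\<integral>\<^sup>+\<sigma>. ennreal (hardy_weight m \<mu> Y (x + \<sigma>)) * unit_cube_weight \<sigma> \<partial>lborel) \<le> ennreal M"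
proof -
  let ?a = "2 * real m / real (card Y)"
  have Y: "Y \<noteq> {}" using assms(1) by auto
  have a: "0 \<le> ?a" "?a < 1" using assms(1) by (simp_all add: divide_less_eq)
  obtain A where A: "A \<ge> 1"
    "\<And>x. (\<integral>\<^sup>+t. ennreal (\<bar>t\<bar> powr (- ?a)) * indicator {x..x+1} t \<partial>lborel) \<le> ennreal A"
    using unit_interval_powr_bound[OF a] by blast
  have "(\<integral>\<^sup>+\<sigma>. ennreal (hardy_weight m \<mu> Y (x + \<sigma>)) * unit_cube_weight \<sigma> \<partial>lborel) \<le> ennreal (\<mu> * A ^ CARD('n))"
    for x :: "real ^ 'n"
  proof -
    let ?I = "\<lambda>i t. indicator {x $ i..x $ i + 1} t :: ennreal"
    let ?f = "\<lambda>i t. (if i \<in> Y then ennreal (\<bar>t\<bar> powr (- ?a)) else 1) * ?I i t"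
    have [measurable]: "?f i \<in> borel_measurable borel" for i
      by (cases "i \<in> Y") simp_all
    have "(\<integral>\<^sup>+\<sigma>. ennreal (hardy_weight m \<mu> Y (x + \<sigma>)) * unit_cube_weight \<sigma> \<partial>lborel)
        = (\<integral>\<^sup>+t. ennreal (hardy_weight m \<mu> Y t) * (\<Prod>i\<in>UNIV. ?I i (t $ i)) \<partial>lborel)"
    proof -
      have "unit_cube_weight \<sigma> = (\<Prod>i\<in>UNIV. ?I i ((1 *\<^sub>R \<sigma> + x) $ i))" for \<sigma>
        unfolding unit_cube_weight_def by (rule prod.cong) (auto simp: indicator_def)
      then show ?thesis
        by (subst nn_integral_scale[of 1 "\<lambda>t. ennreal (hardy_weight m \<mu> Y t) * (\<Prod>i\<in>UNIV. ?I i (t $ i))" x])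
          (simp_all add: add.commute)
    qed
    also have "\<dots> \<le> (\<integral>\<^sup>+t. ennreal \<mu> * (\<Prod>i\<in>UNIV. ?f i (t $ i)) \<partial>lborel)"
    proof (rule nn_integral_mono_AE, rule eventually_mono[OF AE_coordinates_nonzero])
      fix t :: "real ^ 'n" assume t: "\<forall>i. t $ i \<noteq> 0"
      have "ennreal (hardy_weight m \<mu> Y t) \<le> ennreal (\<mu> * (\<Prod>i\<in>Y. \<bar>t $ i\<bar> powr (- ?a)))"
        using hardy_weight_le_prod[OF assms(2) Y, of t m] t by (intro ennreal_leI) blast
      also have "\<dots> = ennreal \<mu> * (\<Prod>i\<in>Y. ennreal (\<bar>t $ i\<bar> powr (- ?a)))"
        using assms(2) by (simp add: ennreal_mult prod_nonneg prod_ennreal)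
      also have "(\<Prod>i\<in>Y. ennreal (\<bar>t $ i\<bar> powr (- ?a)))
          = (\<Prod>i\<in>UNIV. if i \<in> Y then ennreal (\<bar>t $ i\<bar> powr (- ?a)) else 1)"
        by (simp add: prod.If_cases)
      finally have "ennreal (hardy_weight m \<mu> Y t) * (\<Prod>i\<in>UNIV. ?I i (t $ i)) \<le>
          (ennreal \<mu> * (\<Prod>i\<in>UNIV. if i \<in> Y then ennreal (\<bar>t $ i\<bar> powr (- ?a)) else 1)) * (\<Prod>i\<in>UNIV. ?I i (t $ i))"
        by (rule mult_right_mono) simp
      then show "ennreal (hardy_weight m \<mu> Y t) * (\<Prod>i\<in>UNIV. ?I i (t $ i)) \<le> ennreal \<mu> * (\<Prod>i\<in>UNIV. ?f i (t $ i))"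
        by (simp only: prod.distrib mult.assoc)
    qed
    also have "\<dots> = ennreal \<mu> * (\<Prod>i\<in>UNIV. \<integral>\<^sup>+t. ?f i t \<partial>lborel)"
      by (subst nn_integral_cmult, measurable) (subst nn_integral_prod_cart, auto)
    also have "\<dots> \<le> ennreal \<mu> * (\<Prod>i\<in>(UNIV :: 'n set). ennreal A)"
    proof (rule mult_left_mono)
      have "(\<integral>\<^sup>+t. ?f i t \<partial>lborel) \<le> ennreal A" for i
        using A(2)[of "x $ i"] A(1) by (cases "i \<in> Y") (simp_all add: ennreal_ge_1)
      then show "(\<Prod>i\<in>UNIV. \<integral>\<^sup>+t. ?f i t \<partial>lborel) \<le> (\<Prod>i\<in>(UNIV :: 'n set). ennreal A)"
        by (rule prod_mono_ennreal)
    qed simp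
    also have "\<dots> = ennreal (\<mu> * A ^ CARD('n))"
      using A(1) assms(2) by (simp add: ennreal_mult ennreal_power)
    finally show ?thesis .
  qed
  then show ?thesis
    using that[of "\<mu> * A ^ CARD('n)"] A(1) assms(2) by simp
qed

text \<open>
  Averaging over the translations \<open>R \<sigma>\<close>, \<open>\<sigma>\<close> in the unit cube, bounds the mean of the potential energy by
  \<open>R\<^sup>-\<^sup>2\<^sup>m M \<integral> u\<^sup>2\<close>, where \<open>M\<close> bounds the integral of the weight over all unit cubes. So for \<open>R\<close> large some translation
  makes it as small as desired.
\<close>

lemma exists_translation_small_hardy:
  fixes Y :: "'n::finite set" and u :: "real ^ 'n \<Rightarrow> real"
  assumes "2 * m < card Y" "m > 0" "0 \<le> \<mu>" "u \<in> L2" "\<epsilon> > 0"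
  obtains b where "integrable lborel (\<lambda>x. hardy_weight m \<mu> Y (x + b) * (u x)\<^sup>2)"
    "(LINT x|lborel. hardy_weight m \<mu> Y (x + b) * (u x)\<^sup>2) < \<epsilon>"
proof -
  have [measurable]: "u \<in> borel_measurable borel" and u2: "integrable lborel (\<lambda>x. (u x)\<^sup>2)"
    using assms(4) by (auto simp: L2_def)
  let ?W = "\<lambda>x. ennreal (hardy_weight m \<mu> Y x)" and ?u = "\<lambda>x. ennreal ((u x)\<^sup>2)"
  obtain M where M: "0 \<le> M"
    "\<And>x :: real ^ 'n. (\<integral>\<^sup>+\<sigma>. ?W (x + \<sigma>) * unit_cube_weight \<sigma> \<partial>lborel) \<le> ennreal M"
    using hardy_unit_cube_bound[OF assms(1,3)] by blast
  define P where "P = (LINT x|lborel. (u x)\<^sup>2)"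
  have P: "(\<integral>\<^sup>+x. ?u x \<partial>lborel) = ennreal P"
    unfolding P_def using u2 by (intro nn_integral_eq_integral) auto
  have P0: "P \<ge> 0" unfolding P_def by simp
  \<comment> \<open>Large enough for \<open>M P / R\<^sup>2\<^sup>m < \<epsilon>\<close>; the summand \<open>1\<close> ensures \<open>R \<le> R\<^sup>2\<^sup>m\<close>.\<close>
  define R where "R = M * P / \<epsilon> + 1"
  have "M * P / \<epsilon> \<ge> 0" using M(1) P0 assms(5) by simp
  then have R: "R \<ge> 1" "M * P / \<epsilon> < R" by (simp_all add: R_def)
  have small: "M * P / R ^ (2 * m) < \<epsilon>"
  proof -
    have "R \<le> R ^ (2 * m)" using R(1) assms(2) by (intro self_le_power) auto
    then have "M * P / \<epsilon> < R ^ (2 * m)" using R(2) by linarith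
    then show ?thesis using R(1) assms(5) by (simp add: field_simps)
  qed
  have W: "?W (x + R *\<^sub>R \<sigma>) = ennreal (1 / R ^ (2 * m)) * ?W ((1 / R) *\<^sub>R x + \<sigma>)" for x \<sigma> :: "real ^ 'n"
  proof -
    have "x + R *\<^sub>R \<sigma> = R *\<^sub>R ((1 / R) *\<^sub>R x + \<sigma>)"
      using R(1) by (simp add: scaleR_add_right)
    then have "hardy_weight m \<mu> Y (x + R *\<^sub>R \<sigma>) = 1 / R ^ (2 * m) * hardy_weight m \<mu> Y ((1 / R) *\<^sub>R x + \<sigma>)"
      using R(1) by (simp only: hardy_weight_scaleR) simp
    then show ?thesis
      using R(1) by (simp only: ennreal_mult hardy_weight_nonneg[OF assms(3)] zero_le_divide_1_iff zero_le_power)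
  qed
  have "\<exists>\<sigma>. (\<integral>\<^sup>+x. ?W (x + R *\<^sub>R \<sigma>) * ?u x \<partial>lborel) < ennreal \<epsilon>"
  proof (rule ccontr)
    assume "\<not> ?thesis"
    then have ge: "ennreal \<epsilon> \<le> (\<integral>\<^sup>+x. ?W (x + R *\<^sub>R \<sigma>) * ?u x \<partial>lborel)" for \<sigma>
      by (simp add: not_less)
    have "ennreal \<epsilon> = (\<integral>\<^sup>+\<sigma>. ennreal \<epsilon> * unit_cube_weight (\<sigma> :: real ^ 'n) \<partial>lborel)"
      by (subst nn_integral_cmult) (simp_all add: nn_integral_unit_cube)
    also have "\<dots> \<le> (\<integral>\<^sup>+\<sigma>. (\<integral>\<^sup>+x. ?W (x + R *\<^sub>R \<sigma>) * ?u x \<partial>lborel) * unit_cube_weight \<sigma> \<partial>lborel)"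
      by (intro nn_integral_mono mult_right_mono ge) simp
    also have "\<dots> = (\<integral>\<^sup>+\<sigma>. (\<integral>\<^sup>+x. ?W (x + R *\<^sub>R \<sigma>) * ?u x * unit_cube_weight \<sigma> \<partial>lborel) \<partial>lborel)"
      by (subst nn_integral_multc) simp_all
    also have "\<dots> = (\<integral>\<^sup>+x. (\<integral>\<^sup>+\<sigma>. ?W (x + R *\<^sub>R \<sigma>) * ?u x * unit_cube_weight \<sigma> \<partial>lborel) \<partial>lborel)"
      by (rule lborel_pair.Fubini') measurable
    also have "\<dots> \<le> (\<integral>\<^sup>+x. ennreal (1 / R ^ (2 * m) * M) * ?u x \<partial>lborel)"
    proof (rule nn_integral_mono)
      fix x :: "real ^ 'n"
      have "(\<integral>\<^sup>+\<sigma>. ?W (x + R *\<^sub>R \<sigma>) * ?u x * unit_cube_weight \<sigma> \<partial>lborel)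
          = (\<integral>\<^sup>+\<sigma>. (ennreal (1 / R ^ (2 * m)) * ?u x) * (?W ((1 / R) *\<^sub>R x + \<sigma>) * unit_cube_weight \<sigma>) \<partial>lborel)"
        by (rule nn_integral_cong) (simp only: W mult_ac)
      also have "\<dots> = (ennreal (1 / R ^ (2 * m)) * ?u x) * (\<integral>\<^sup>+\<sigma>. ?W ((1 / R) *\<^sub>R x + \<sigma>) * unit_cube_weight \<sigma> \<partial>lborel)"
        by (rule nn_integral_cmult) measurable
      also have "\<dots> \<le> (ennreal (1 / R ^ (2 * m)) * ?u x) * ennreal M"
        by (intro mult_left_mono M) simp
      also have "\<dots> = ennreal (1 / R ^ (2 * m) * M) * ?u x"
      proof -
        have "ennreal (1 / R ^ (2 * m) * M) = ennreal (1 / R ^ (2 * m)) * ennreal M"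
          using R(1) M(1) by (intro ennreal_mult) auto
        then show ?thesis by (simp only: mult_ac)
      qed
      finally show "(\<integral>\<^sup>+\<sigma>. ?W (x + R *\<^sub>R \<sigma>) * ?u x * unit_cube_weight \<sigma> \<partial>lborel) \<le> ennreal (1 / R ^ (2 * m) * M) * ?u x" .
    qed
    also have "\<dots> = ennreal (1 / R ^ (2 * m) * M) * ennreal P"
      by (subst nn_integral_cmult) (simp_all add: P)
    also have "\<dots> = ennreal (M * P / R ^ (2 * m))"
      using R(1) M(1) P0 by (simp add: ennreal_mult[symmetric])
    also have "\<dots> < ennreal \<epsilon>"
      using small assms(5) by (simp add: ennreal_less_iff M(1) P0 R(1))
    finally show False by simp
  qed
  then obtain \<sigma> where \<sigma>: "(\<integral>\<^sup>+x. ?W (x + R *\<^sub>R \<sigma>) * ?u x \<partial>lborel) < ennreal \<epsilon>" by blast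
  define f where "f x = hardy_weight m \<mu> Y (x + R *\<^sub>R \<sigma>) * (u x)\<^sup>2" for x
  have f0: "0 \<le> f x" for x
    by (simp add: f_def hardy_weight_nonneg assms(3))
  have [measurable]: "f \<in> borel_measurable borel"
    unfolding f_def by measurable
  have nn: "(\<integral>\<^sup>+x. ennreal (f x) \<partial>lborel) < ennreal \<epsilon>"
    using \<sigma> by (simp add: f_def ennreal_mult hardy_weight_nonneg assms(3))
  have fin: "(\<integral>\<^sup>+x. ennreal (f x) \<partial>lborel) < top"
    by (rule order.strict_trans[OF nn ennreal_less_top])
  have int: "integrable lborel f"
    by (rule integrableI_nonneg) (simp_all add: f0 fin)
  moreover have "(LINT x|lborel. f x) < \<epsilon>"
    using nn nn_integral_eq_integral[OF int] f0 by (simp add: ennreal_less_iff)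
  ultimately show ?thesis unfolding f_def by (rule that)
qed

section \<open>Dilating onto the constraint\<close>

text \<open>
  At the mass-critical exponent \<open>p\<close> one has \<open>\<delta> p = 2\<close> and \<open>(1 - \<delta>) p = 4 m / N\<close>, so the \<open>p\<close>-th power of the
  Gagliardo--Nirenberg inequality is linear in \<open>\<integral> |\<nabla>\<^sup>m u|\<^sup>2\<close>.
\<close>

lemma GN_mass_critical:
  fixes u :: "real ^ 'n::finite \<Rightarrow> real"
  assumes "GN_inequality TYPE('n) m C" "C > 0" "m > 0" "u \<in> sobolev m"
  shows "integrable lborel (\<lambda>x. \<bar>u x\<bar> powr mass_exp CARD('n) m)"
    and "(LINT x|lborel. \<bar>u x\<bar> powr mass_exp CARD('n) m)
      \<le> C powr mass_exp CARD('n) m * (LINT x|lborel. nabla_inner m u u x)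
          * (LINT x|lborel. (u x)\<^sup>2) powr (2 * real m / CARD('n))"
proof -
  let ?p = "mass_exp CARD('n) m" and ?\<delta> = "GN_delta CARD('n) m"
  define I where "I = (LINT x|lborel. \<bar>u x\<bar> powr ?p)"
  define D where "D = (LINT x|lborel. nabla_inner m u u x)"
  define P where "P = (LINT x|lborel. (u x)\<^sup>2)"
  have pos: "I \<ge> 0" "D \<ge> 0" "P \<ge> 0"
    by (simp_all add: I_def D_def P_def nabla_inner_nonneg)
  show "integrable lborel (\<lambda>x. \<bar>u x\<bar> powr ?p)"
    using assms by (simp add: GN_inequality_def)
  have p: "?p > 0" by (simp add: mass_exp_def add_pos_nonneg)
  have \<delta>p: "?\<delta> * ?p = 2"
  proof -
    have "?\<delta> * ?p = CARD('n) / m * (?p / 2 - 1)"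
      using p by (simp add: GN_delta_def left_diff_distrib)
    also have "?p / 2 - 1 = 2 * real m / CARD('n)" by (simp add: mass_exp_def add_divide_distrib)
    finally show ?thesis using assms(3) by simp
  qed
  have sq: "\<bar>t\<bar> powr 2 = t\<^sup>2" for t :: real
    using powr_numeral[of "\<bar>t\<bar>" "Num.Bit0 Num.One"] by simp
  have "Lnorm ?p u = I powr (1 / ?p)" by (simp add: Lnorm_def I_def)
  moreover have "Lnorm 2 (\<lambda>x. sqrt (nabla_inner m u u x)) = D powr (1 / 2)"
    unfolding Lnorm_def D_def sq by (simp add: nabla_inner_nonneg)
  moreover have "Lnorm 2 u = P powr (1 / 2)"
    unfolding Lnorm_def P_def sq ..
  ultimately have "I powr (1 / ?p) \<le> C * (D powr (1 / 2)) powr ?\<delta> * (P powr (1 / 2)) powr (1 - ?\<delta>)"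
    using assms(1,4) unfolding GN_inequality_def by metis
  then have "(I powr (1 / ?p)) powr ?p \<le> (C * (D powr (1 / 2)) powr ?\<delta> * (P powr (1 / 2)) powr (1 - ?\<delta>)) powr ?p"
    using p by (intro powr_mono2) auto
  also have "(I powr (1 / ?p)) powr ?p = I"
    using p pos by (simp add: powr_powr)
  also have "(C * (D powr (1 / 2)) powr ?\<delta> * (P powr (1 / 2)) powr (1 - ?\<delta>)) powr ?p
      = C powr ?p * D powr (1 / 2 * ?\<delta> * ?p) * P powr (1 / 2 * (1 - ?\<delta>) * ?p)"
    using assms(2) by (simp only: powr_mult powr_powr)
  also have "1 / 2 * ?\<delta> * ?p = 1" using \<delta>p by simp
  also have "1 / 2 * (1 - ?\<delta>) * ?p = 2 * real m / CARD('n)"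
    using \<delta>p by (simp add: left_diff_distrib mass_exp_def)
  also have "D powr 1 = D" using pos by simp
  finally show "I \<le> C powr ?p * D * P powr (2 * real m / CARD('n))" .
qed

text \<open>
  \<open>F r = r\<^sup>-\<^sup>p \<integral> H (r u)\<close> is continuous on \<open>(0, 1]\<close>, because its integrand is dominated by \<open>H u\<close>. As \<open>r \<rightarrow> 0\<close> the
  integrand is eventually at most \<open>e' |u|\<^sup>p\<close> at each point, so the limes superior of \<open>F\<close> is at most \<open>e' \<integral> |u|\<^sup>p\<close>.
  The intermediate value theorem yields all values between this bound and \<open>F 1 = \<integral> H u\<close>.
\<close>

lemma exists_scale_with_prescribed_H:
  fixes u :: "'a \<Rightarrow> real"
  assumes A: "A0 N m g" "A4 N m g" "A5 N m g" "N > 0" "m > 0"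
    and eta: "eta N m g = ereal e" "e < e'"
    and u [measurable]: "u \<in> borel_measurable M"
    and Hu: "integrable M (\<lambda>x. H_of g (u x))" and up: "integrable M (\<lambda>x. \<bar>u x\<bar> powr mass_exp N m)"
    and T: "e' * (LINT x|M. \<bar>u x\<bar> powr mass_exp N m) < T" "T \<le> (LINT x|M. H_of g (u x))"
  obtains r where "0 < r" "r \<le> 1" "integrable M (\<lambda>x. H_of g (r * u x))"
    "(LINT x|M. H_of g (r * u x)) = r powr mass_exp N m * T"
proof -
  let ?p = "mass_exp N m"
  define f where "f r x = r powr (- ?p) * H_of g (r * u x)" for r x
  have cont: "continuous_on UNIV (H_of g)"
    by (intro continuous_at_imp_continuous_on ballI DERIV_isCont[OF H_of_has_derivative[OF A(1)]])
  have [measurable]: "H_of g \<in> borel_measurable borel"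
    by (rule borel_measurable_continuous_onI[OF cont])
  have f0: "0 \<le> f r x" for r x
    unfolding f_def by (intro mult_nonneg_nonneg G_H_bounds[OF A(3-5)]) simp
  have f1: "f r x \<le> H_of g (u x)" if "0 < r" "r \<le> 1" for r x
    using H_of_scale_le[OF A(1,2) that, of "u x"] that(1) by (simp add: f_def powr_minus field_simps)
  have [measurable]: "f r \<in> borel_measurable M" for r
    unfolding f_def by measurable
  have fint: "integrable M (f r)" if "0 < r" "r \<le> 1" for r
  proof (rule Bochner_Integration.integrable_bound[OF Hu])
    show "AE x in M. norm (f r x) \<le> norm (H_of g (u x))"
      using f1[OF that] by (intro AE_I2) (simp add: f0 G_H_bounds(3)[OF A(3-5)])
  qed measurable
  define F where "F r = (LINT x|M. f r x)" for r
  have F1: "F 1 = (LINT x|M. H_of g (u x))" by (simp add: F_def f_def)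
  have Fcont: "continuous_on {r0..1} F" if "0 < r0" for r0
  proof (rule continuous_on_sequentiallyI)
    fix \<rho> r assume s: "\<forall>n. \<rho> n \<in> {r0..1}" "r \<in> {r0..1}" "\<rho> \<longlonglongrightarrow> r"
    show "(\<lambda>n. F (\<rho> n)) \<longlonglongrightarrow> F r"
      unfolding F_def
    proof (rule integral_dominated_convergence[OF _ _ Hu])
      show "AE x in M. (\<lambda>n. f (\<rho> n) x) \<longlonglongrightarrow> f r x"
      proof (rule AE_I2)
        fix x
        have "(\<lambda>n. H_of g (\<rho> n * u x)) \<longlonglongrightarrow> H_of g (r * u x)"
          by (rule continuous_on_tendsto_compose[OF cont]) (use s in \<open>auto intro!: tendsto_mult_right\<close>)
        then show "(\<lambda>n. f (\<rho> n) x) \<longlonglongrightarrow> f r x"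
          unfolding f_def using s that by (intro tendsto_intros) auto
      qed
      show "AE x in M. norm (f (\<rho> n) x) \<le> H_of g (u x)" for n
        using s(1)[rule_format, of n] that f1[of "\<rho> n"] by (intro AE_I2) (simp add: f0)
    qed measurable
  qed
  let ?I = "LINT x|M. \<bar>u x\<bar> powr ?p"
  let ?r = "\<lambda>n. inverse (real (Suc n))"
  \<comment> \<open>The excess over \<open>e' |u|\<^sup>p\<close>: it vanishes eventually at each point and is dominated by \<open>H u\<close>.\<close>
  let ?h = "\<lambda>r x. max 0 (f r x - e' * \<bar>u x\<bar> powr ?p)"
  have e: "0 \<le> e'"
  proof (rule ccontr)
    assume "\<not> 0 \<le> e'"
    obtain d where d: "d > 0" "\<And>t. \<bar>t\<bar> < d \<Longrightarrow> H_of g t \<le> e' * \<bar>t\<bar> powr ?p"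
      using H_of_le_near_0[OF eta] by blast
    have "H_of g (d / 2) \<le> e' * \<bar>d / 2\<bar> powr ?p" using d(1) by (intro d(2)) simp
    also have "\<dots> < 0" using \<open>\<not> 0 \<le> e'\<close> d(1) by (intro mult_neg_pos) auto
    finally show False using G_H_bounds(3)[OF A(3-5), of "d / 2"] by simp
  qed
  have "(\<lambda>n. LINT x|M. ?h (?r n) x) \<longlonglongrightarrow> (LINT x|M. 0)"
  proof (rule integral_dominated_convergence[OF _ _ Hu])
    show "AE x in M. (\<lambda>n. ?h (?r n) x) \<longlonglongrightarrow> 0"
    proof (rule AE_I2)
      fix x
      obtain d where d: "d > 0" "\<And>t. \<bar>t\<bar> < d \<Longrightarrow> H_of g t \<le> e' * \<bar>t\<bar> powr ?p"
        using H_of_le_near_0[OF eta] by blast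
      have "(\<lambda>n. \<bar>?r n * u x\<bar>) \<longlonglongrightarrow> \<bar>0 * u x\<bar>"
        by (intro tendsto_intros LIMSEQ_inverse_real_of_nat)
      then have "\<forall>\<^sub>F n in sequentially. \<bar>?r n * u x\<bar> < d"
        using d(1) by (intro order_tendstoD) auto
      then have "\<forall>\<^sub>F n in sequentially. ?h (?r n) x = 0"
      proof eventually_elim
        case (elim n)
        have "f (?r n) x \<le> ?r n powr (- ?p) * (e' * \<bar>?r n * u x\<bar> powr ?p)"
          unfolding f_def by (intro mult_left_mono d(2) elim) simp
        also have "\<dots> = e' * \<bar>u x\<bar> powr ?p * (?r n powr (- ?p) * ?r n powr ?p)"
          by (simp add: abs_mult powr_mult del: of_nat_Suc)
        also have "?r n powr (- ?p) * ?r n powr ?p = 1"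
          by (simp flip: powr_add del: of_nat_Suc)
        finally show ?case by simp
      qed
      then show "(\<lambda>n. ?h (?r n) x) \<longlonglongrightarrow> 0"
        by (rule tendsto_eventually)
    qed
    show "AE x in M. norm (?h (?r n) x) \<le> H_of g (u x)" for n
    proof (rule AE_I2)
      fix x
      have "f (?r n) x \<le> H_of g (u x)"
        by (rule f1) (simp_all add: inverse_le_1_iff)
      moreover have "0 \<le> e' * \<bar>u x\<bar> powr ?p" using e by simp
      moreover have "0 \<le> H_of g (u x)" by (rule G_H_bounds(3)[OF A(3-5)])
      ultimately show "norm (?h (?r n) x) \<le> H_of g (u x)" by (simp add: max_def)
    qed
  qed measurable
  then have "\<forall>\<^sub>F n in sequentially. (LINT x|M. ?h (?r n) x) < T - e' * ?I"
    using T(1) by (intro order_tendstoD(2)) auto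
  then obtain n where n: "(LINT x|M. ?h (?r n) x) < T - e' * ?I"
    by (auto simp: eventually_sequentially)
  have rn: "0 < ?r n" "?r n \<le> 1" by (simp_all add: inverse_le_1_iff)
  have hint: "integrable M (?h (?r n))"
    by (intro Bochner_Integration.integrable_max integrable_zero Bochner_Integration.integrable_diff
        integrable_mult_right fint rn up)
  have "F (?r n) \<le> (LINT x|M. ?h (?r n) x + e' * \<bar>u x\<bar> powr ?p)"
    unfolding F_def by (intro integral_mono fint rn Bochner_Integration.integrable_add hint integrable_mult_right up) simp
  also have "\<dots> = (LINT x|M. ?h (?r n) x) + e' * ?I"
    using hint up by simp
  finally have "F (?r n) \<le> T" using n by simp
  then obtain r where r: "?r n \<le> r" "r \<le> 1" "F r = T"
    using IVT'[of F "?r n" T 1] T(2) F1 rn Fcont[OF rn(1)] by auto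
  have r0: "0 < r" using r(1) rn(1) by linarith
  have eq: "H_of g (r * u x) = r powr ?p * f r x" for x
    using r0 by (simp add: f_def powr_minus)
  show ?thesis
  proof (rule that[OF r0 r(2)])
    show "integrable M (\<lambda>x. H_of g (r * u x))"
      unfolding eq by (intro integrable_mult_right fint r0 r(2))
    show "(LINT x|M. H_of g (r * u x)) = r powr ?p * T"
      unfolding eq r(3)[symmetric] F_def by simp
  qed
qed

section \<open>Functions of lower energy\<close>

lemma quad_density_split:
  assumes "integrable lborel (quad_density m \<mu> Y u)" "0 \<le> \<mu>" "u \<in> borel_measurable borel"
  shows "integrable lborel (\<lambda>x. hardy_weight m \<mu> Y x * (u x)\<^sup>2)" "integrable lborel (nabla_inner m u u)"
proof -
  note assms(3)[measurable]
  have nn: "0 \<le> hardy_weight m \<mu> Y x * (u x)\<^sup>2" for x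
    by (simp add: hardy_weight_nonneg assms(2))
  show i: "integrable lborel (\<lambda>x. hardy_weight m \<mu> Y x * (u x)\<^sup>2)"
  proof (rule Bochner_Integration.integrable_bound[OF assms(1)])
    show "AE x in lborel. norm (hardy_weight m \<mu> Y x * (u x)\<^sup>2) \<le> norm (quad_density m \<mu> Y u x)"
      using nn nabla_inner_nonneg[of m u] by (intro AE_I2) (simp add: quad_density_def add_nonneg_nonneg)
  qed measurable
  from Bochner_Integration.integrable_diff[OF assms(1) i] show "integrable lborel (nabla_inner m u u)"
    by (simp add: quad_density_def)
qed

text \<open>
  The potential is positive away from the null set of points with a vanishing coordinate.
\<close>

lemma integral_hardy_pos:
  fixes Y :: "'n::finite set"
  assumes "integrable lborel (\<lambda>x. hardy_weight m \<mu> Y x * (u x)\<^sup>2)" "0 < \<mu>" "Y \<noteq> {}" "\<not> (AE x in lborel. u x = 0)"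
  shows "0 < (LINT x|lborel. hardy_weight m \<mu> Y x * (u x)\<^sup>2)"
proof (rule ccontr)
  have nn: "0 \<le> hardy_weight m \<mu> Y x * (u x)\<^sup>2" for x
    using assms(2) by (simp add: hardy_weight_nonneg)
  assume "\<not> ?thesis"
  moreover have "0 \<le> (LINT x|lborel. hardy_weight m \<mu> Y x * (u x)\<^sup>2)"
    by (intro integral_nonneg_AE AE_I2 nn)
  ultimately have "(LINT x|lborel. hardy_weight m \<mu> Y x * (u x)\<^sup>2) = 0" by linarith
  then have "AE x in lborel. hardy_weight m \<mu> Y x * (u x)\<^sup>2 = 0"
    using integral_nonneg_eq_0_iff_AE[OF assms(1)] nn by simp
  with AE_coordinates_nonzero have "AE x in lborel. u x = 0"
  proof eventually_elim
    case (elim x)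
    obtain j where "j \<in> Y" using assms(3) by blast
    then have "L2_set (\<lambda>i. x $ i) Y \<noteq> 0"
      using elim(1) by (auto simp: L2_set_eq_0_iff)
    then show ?case using elim(2) assms(2) by (simp add: hardy_weight_def)
  qed
  then show False using assms(4) by simp
qed

text \<open>
  With \<open>D = \<integral> |\<nabla>\<^sup>m u|\<^sup>2\<close> and the potential energy \<open>V > 0\<close> of \<open>u\<close>, a translation replaces \<open>V\<close> by some \<open>V' < V\<close>. The
  smallness condition says that \<open>(N / 2m) \<eta> \<integral> |u|\<^sup>p < D\<close>, so \<open>D + V'\<close> lies in the range of values that the
  dilation parameter can realise, and the translated function can be dilated back onto the constraint.
\<close>

lemma exists_lower_energy:
  fixes Y :: "'n::finite set" and u :: "real ^ 'n \<Rightarrow> real"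
  assumes m: "m \<ge> 1" and N: "N = CARD('n)" and Y: "card Y > 2 * m" and \<mu>: "\<mu> > 0" and \<rho>: "\<rho> > 0"
    and A: "A0 N m g" "A1 N m g" "A4 N m g" "A5 N m g"
    and C: "GN_optimal TYPE('n) m C"
    and small: "ereal (real N / (2 * real m)) * eta N m g * ereal (C powr mass_exp N m)
           * ereal (\<rho> powr (2 * real m / real N)) < 1"
    and u: "u \<in> constraint_set m \<mu> Y g" and mass: "(LINT x|lborel. (u x)\<^sup>2) \<le> \<rho>"
  obtains w where "w \<in> constraint_set m \<mu> Y g" "w \<in> L2"
    "(LINT x|lborel. (w x)\<^sup>2) = (LINT x|lborel. (u x)\<^sup>2)" "J m \<mu> Y g w < J m \<mu> Y g u"
proof -
  let ?p = "mass_exp N m"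
  have N0: "N > 0" by (simp add: N)
  have m0: "m > 0" using m by simp
  have \<mu>0: "0 \<le> \<mu>" using \<mu> by simp
  have Y0: "Y \<noteq> {}" using Y by auto
  have us: "u \<in> sobolev m" and unz: "\<not> (AE x in lborel. u x = 0)"
    and q: "integrable lborel (quad_density m \<mu> Y u)" and Hu: "integrable lborel (\<lambda>x. H_of g (u x))"
    and con: "(LINT x|lborel. quad_density m \<mu> Y u x) = N / (2 * m) * (LINT x|lborel. H_of g (u x))"
    using u by (simp_all add: constraint_set_def N)
  have uL2: "u \<in> L2" using us by (simp add: sobolev_def)
  then have um [measurable]: "u \<in> borel_measurable borel" by (simp add: L2_def)
  note hardy = quad_density_split(1)[OF q \<mu>0 um] and nabla = quad_density_split(2)[OF q \<mu>0 um]
  define D where "D = (LINT x|lborel. nabla_inner m u u x)"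
  define V where "V = (LINT x|lborel. hardy_weight m \<mu> Y x * (u x)\<^sup>2)"
  define I where "I = (LINT x|lborel. \<bar>u x\<bar> powr ?p)"
  define P where "P = (LINT x|lborel. (u x)\<^sup>2)"
  have Q: "(LINT x|lborel. quad_density m \<mu> Y u x) = D + V"
    unfolding quad_density_def D_def V_def by (rule Bochner_Integration.integral_add[OF nabla hardy])
  have V0: "V > 0"
    unfolding V_def by (rule integral_hardy_pos[OF hardy \<mu> Y0 unz])
  obtain b where b: "integrable lborel (\<lambda>x. hardy_weight m \<mu> Y (x + b) * (u x)\<^sup>2)"
    "(LINT x|lborel. hardy_weight m \<mu> Y (x + b) * (u x)\<^sup>2) < V"
    using exists_translation_small_hardy[OF Y m0 \<mu>0 uL2 V0] by blast
  define V' where "V' = (LINT x|lborel. hardy_weight m \<mu> Y (x + b) * (u x)\<^sup>2)"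
  have V': "0 \<le> V'" "V' < V"
    using b(2) by (auto simp: V'_def hardy_weight_nonneg \<mu>0 intro!: integral_nonneg_AE)

  have C0: "C > 0" "GN_inequality TYPE('n) m C" using C by (simp_all add: GN_optimal_def)
  note up = GN_mass_critical(1)[OF C0(2,1) m0 us, folded N]
  have GN: "I \<le> C powr ?p * D * P powr (2 * real m / N)"
    using GN_mass_critical(2)[OF C0(2,1) m0 us, folded N] by (simp add: I_def D_def P_def)
  have P: "0 \<le> P" "P \<le> \<rho>" using mass by (simp_all add: P_def)
  have D0: "0 \<le> D" by (simp add: D_def nabla_inner_nonneg)
  have I0: "0 < I"
  proof (rule ccontr)
    assume "\<not> 0 < I"
    moreover have "0 \<le> I" by (simp add: I_def)
    ultimately have "I = 0" by linarith
    then have "AE x in lborel. \<bar>u x\<bar> powr ?p = 0"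
      using integral_nonneg_eq_0_iff_AE[OF up] by (simp add: I_def)
    then show False using unz by simp
  qed
  have GN': "I \<le> C powr ?p * \<rho> powr (2 * real m / N) * D"
  proof -
    have "C powr ?p * D * P powr (2 * real m / N) \<le> C powr ?p * D * \<rho> powr (2 * real m / N)"
      using P D0 by (intro mult_left_mono powr_mono2) auto
    then show ?thesis using GN by (simp add: mult_ac)
  qed
  then have Dpos: "0 < D"
    using I0 D0 by (cases "D = 0") auto

  obtain e where e: "eta N m g = ereal e" "0 \<le> e"
    using eta_real[OF A(2,4) N0 m0] by blast
  define k where "k = N / (2 * m) * (C powr ?p * \<rho> powr (2 * real m / N))"
  have k0: "k > 0" using N0 m0 C0 \<rho> by (simp add: k_def)
  have "e * k < 1"
    using small by (simp add: e(1) k_def mult_ac one_ereal_def)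
  then have ek: "e < 1 / k" using k0 by (simp add: pos_less_divide_eq)
  \<comment> \<open>The strict inequality leaves room between \<open>\<eta>\<close> and the largest admissible coefficient; \<open>e'\<close> is taken halfway.\<close>
  define e' where "e' = (e + 1 / k) / 2"
  have e': "e < e'" "e' * k < 1" "0 < e'"
    using ek e(2) k0 \<open>e * k < 1\<close> by (simp_all add: e'_def field_simps add_pos_nonneg)
  \<comment> \<open>The value of \<open>r\<^sup>-\<^sup>p \<integral> H (r u)\<close> that puts the translated and dilated function on the constraint.\<close>
  define T where "T = 2 * m / N * (D + V')"
  have T1: "e' * I < T"
  proof -
    have "N / (2 * m) * (e' * I) \<le> N / (2 * m) * (e' * (C powr ?p * \<rho> powr (2 * real m / N) * D))"
      using GN' e'(3) by (intro mult_left_mono) auto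
    also have "\<dots> = (e' * k) * D" by (simp add: k_def mult_ac)
    also have "\<dots> < 1 * D" using e'(2) Dpos by (intro mult_strict_right_mono)
    also have "\<dots> \<le> D + V'" using V' by simp
    finally have "N / (2 * m) * (e' * I) < D + V'" .
    then show ?thesis using N0 m0 by (simp add: T_def field_simps)
  qed
  have HQ: "(LINT x|lborel. H_of g (u x)) = 2 * m / N * (D + V)"
    using con Q N0 m0 by (simp add: field_simps)
  have T2: "T \<le> (LINT x|lborel. H_of g (u x))"
    unfolding HQ T_def using V' by (intro mult_left_mono) auto
  obtain r where r: "0 < r" "r \<le> 1" "integrable lborel (\<lambda>x. H_of g (r * u x))"
    "(LINT x|lborel. H_of g (r * u x)) = r powr ?p * T"
    using exists_scale_with_prescribed_H[OF A(1,3,4) N0 m0 e(1) e'(1) _ Hu up T1[unfolded I_def] T2] by auto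
  \<comment> \<open>The amplitude is \<open>r = s\<^sup>N\<^sup>/\<^sup>2\<close>, as required for preserving the \<open>L\<^sup>2\<close>-norm.\<close>
  define s where "s = r powr (2 / N)"
  have s: "0 < s" "s \<le> 1" using r N0 by (auto simp: s_def powr_le1)
  have sr: "s powr (N / 2) = r" using r N0 by (simp add: s_def powr_powr)
  have r2: "r\<^sup>2 = s ^ N"
    using s by (simp add: sr[symmetric] powr_power powr_realpow)
  have rp: "r powr ?p = s ^ N * s ^ (2 * m)"
  proof -
    have "r powr ?p = s powr (N / 2 * ?p)" by (simp only: sr[symmetric] powr_powr)
    also have "N / 2 * ?p = N + real (2 * m)" using N0 by (simp add: mass_exp_def field_simps)
    also have "s powr (N + real (2 * m)) = s ^ N * s ^ (2 * m)"
      using s by (simp only: powr_add powr_realpow)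
    finally show ?thesis .
  qed

  define w where "w x = r * u (s *\<^sub>R x + - b)" for x
  \<comment> \<open>The energy density of \<open>w\<close> in the coordinates of \<open>u\<close>: the translation acts on the potential only.\<close>
  define q' where "q' x = nabla_inner m u u x + hardy_weight m \<mu> Y (x + b) * (u x)\<^sup>2" for x
  have q'int: "integrable lborel q'" and q'val: "(LINT x|lborel. q' x) = D + V'"
    unfolding q'_def D_def V'_def using nabla b(1) by simp_all
  have ws: "w \<in> sobolev m"
    unfolding w_def[abs_def] by (rule sobolev_scale[OF us s(1)])
  have [measurable]: "w \<in> borel_measurable borel" unfolding w_def[abs_def] by measurable
  have wq: "AE x in lborel. quad_density m \<mu> Y w x = (s ^ N * s ^ (2 * m)) * q' (s *\<^sub>R x + - b)"
    using nabla_inner_scale[OF sobolev_has_weak_derivs[OF us] s(1), of r "- b", folded w_def[abs_def]]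
  proof eventually_elim
    case (elim x)
    have "hardy_weight m \<mu> Y x = s ^ (2 * m) * hardy_weight m \<mu> Y ((s *\<^sub>R x + - b) + b)"
      using s(1) hardy_weight_scaleR[OF s(1), of m \<mu> Y x] by simp
    then show ?case
      using elim by (simp add: quad_density_def q'_def w_def r2[symmetric] power_mult_distrib algebra_simps)
  qed
  have [measurable]: "quad_density m \<mu> Y w \<in> borel_measurable borel"
    using nabla_inner_measurable[OF sobolev_has_weak_derivs[OF ws]] unfolding quad_density_def[abs_def] by measurable
  have q's: "integrable lborel (\<lambda>x. (s ^ N * s ^ (2 * m)) * q' (s *\<^sub>R x + - b))"
    using s by (intro integrable_mult_right integrable_scale q'int) simp
  have wqint: "integrable lborel (quad_density m \<mu> Y w)"
    by (rule integrable_cong_AE_imp[OF q's]) (use wq in \<open>auto elim: eventually_mono\<close>)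
  have sc: "(LINT x|lborel. f (s *\<^sub>R x + - b)) = (LINT x|lborel. f x) / s ^ N" for f :: "real ^ 'n \<Rightarrow> real"
    unfolding N by (rule integral_scale[OF s(1)])
  have wqval: "(LINT x|lborel. quad_density m \<mu> Y w x) = s ^ (2 * m) * (D + V')"
  proof -
    have "(LINT x|lborel. quad_density m \<mu> Y w x) = (LINT x|lborel. (s ^ N * s ^ (2 * m)) * q' (s *\<^sub>R x + - b))"
      by (rule integral_cong_AE) (use wq borel_measurable_integrable[OF q's] in simp_all)
    also have "\<dots> = s ^ (2 * m) * (D + V')"
      using s(1) sc[of q'] by (simp add: q'val)
    finally show ?thesis .
  qed
  have wH: "integrable lborel (\<lambda>x. H_of g (w x))"
    unfolding w_def using integrable_scale[OF _ r(3), of s "- b"] s by simp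
  have wHval: "(LINT x|lborel. H_of g (w x)) = s ^ (2 * m) * T"
    unfolding w_def using sc[of "\<lambda>x. H_of g (r * u x)"] r(4) rp s(1) by simp
  have wnz: "\<not> (AE x in lborel. w x = 0)"
  proof
    assume "AE x in lborel. w x = 0"
    then have "AE x in lborel. w ((1 / s) *\<^sub>R x + - ((1 / s) *\<^sub>R (- b))) = 0"
      using s by (intro AE_scale[of "1 / s" "\<lambda>x. w x = 0"]) simp_all
    moreover have "s \<noteq> 0" using s by simp
    ultimately show False
      using unz r(1) unfolding w_def affine_inverse(1)[OF \<open>s \<noteq> 0\<close>] by simp
  qed
  have wc: "w \<in> constraint_set m \<mu> Y g"
    unfolding constraint_set_def
    using ws wnz wqint wH wqval wHval N0 m0 by (simp add: T_def N[symmetric])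
  have wL2: "w \<in> L2" using ws by (simp add: sobolev_def)
  have wmass: "(LINT x|lborel. (w x)\<^sup>2) = (LINT x|lborel. (u x)\<^sup>2)"
    unfolding w_def power_mult_distrib using sc[of "\<lambda>x. (u x)\<^sup>2"] s(1) by (simp add: r2)

  have [measurable]: "G_of g \<in> borel_measurable borel"
  proof (rule borel_measurable_continuous_onI)
    have "continuous_on UNIV g" using A(1) by (simp add: A0_def)
    from DERIV_isCont[OF G_of_has_derivative[OF this]] show "continuous_on UNIV (G_of g)"
      by (intro continuous_at_imp_continuous_on ballI)
  qed
  have Gint: "integrable lborel (\<lambda>x. G_of g (v x))"
    if "integrable lborel (\<lambda>x. H_of g (v x))" and [measurable]: "v \<in> borel_measurable borel" for v :: "real ^ 'n \<Rightarrow> real"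
  proof (rule Bochner_Integration.integrable_bound)
    show "integrable lborel (\<lambda>x. N / (4 * m) * H_of g (v x))"
      using that(1) by (rule integrable_mult_right)
    show "AE x in lborel. norm (G_of g (v x)) \<le> norm (N / (4 * m) * H_of g (v x))"
    proof (rule AE_I2)
      fix x
      have "G_of g (v x) \<le> N / (4 * m) * H_of g (v x)"
        using G_H_bounds(2)[OF A(4) N0 m0, of "v x"] N0 m0 by (simp add: field_simps)
      then show "norm (G_of g (v x)) \<le> norm (N / (4 * m) * H_of g (v x))"
        using G_H_bounds(1)[OF A(4) N0 m0, of "v x"] unfolding real_norm_def by linarith
    qed
  qed measurable
  have Gu: "integrable lborel (\<lambda>x. G_of g (u x))" and Gr: "integrable lborel (\<lambda>x. G_of g (r * u x))"
    by (auto intro!: Gint Hu r(3))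
  have "(LINT x|lborel. G_of g (u x)) - (LINT x|lborel. G_of g (r * u x)) / s ^ N
      = (LINT x|lborel. G_of g (u x) - G_of g (r * u x) / s ^ N)"
    using Gu Gr by simp
  also have "\<dots> \<le> (LINT x|lborel. N / (4 * m) * (1 - s ^ (2 * m)) * H_of g (u x))"
    using fiber_energy_le[OF A(1,3) N0 m0 s] Gu Gr Hu
    by (intro integral_mono) (simp_all add: sr)
  also have "\<dots> = N / (4 * m) * (1 - s ^ (2 * m)) * (2 * m / N * (D + V))"
    by (simp add: HQ)
  also have "\<dots> = 1 / 2 * (1 - s ^ (2 * m)) * (D + V)"
    using N0 m0 by (simp add: field_simps)
  finally have fib: "(LINT x|lborel. G_of g (u x)) - (LINT x|lborel. G_of g (r * u x)) / s ^ N
      \<le> 1 / 2 * (1 - s ^ (2 * m)) * (D + V)" .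
  have "J m \<mu> Y g w = 1 / 2 * (s ^ (2 * m) * (D + V')) - (LINT x|lborel. G_of g (r * u x)) / s ^ N"
    unfolding J_def wqval using sc[of "\<lambda>x. G_of g (r * u x)"] by (simp add: w_def)
  also have "\<dots> < 1 / 2 * (s ^ (2 * m) * (D + V)) - (LINT x|lborel. G_of g (r * u x)) / s ^ N"
    using s V' by simp
  also have "\<dots> \<le> 1 / 2 * (D + V) - (LINT x|lborel. G_of g (u x))"
  proof -
    have "1 / 2 * (1 - s ^ (2 * m)) * (D + V) = 1 / 2 * (D + V) - 1 / 2 * (s ^ (2 * m) * (D + V))"
      by (simp add: left_diff_distrib right_diff_distrib)
    then show ?thesis using fib by linarith
  qed
  also have "\<dots> = J m \<mu> Y g u" by (simp add: J_def Q)
  finally show ?thesis using that wc wL2 wmass by blast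
qed

theorem theorem3p4:
  fixes m N K :: nat and Y :: "'n::finite set" and \<mu> \<rho> C :: real and g :: "real \<Rightarrow> real"
  assumes "m \<ge> 1"
    and "N = CARD('n)" and "K = card Y" and "N \<ge> K" and "K > 2 * m"
    and "\<mu> > 0" and "\<rho> > 0"
    and "A0 N m g" and "A1 N m g" and "A2 N m g" and "A3 N m g" and "A4 N m g" and "A5 N m g"
    and "GN_optimal TYPE('n) m C"
    and "ereal (real N / (2 * real m)) * eta N m g * ereal (C powr mass_exp N m)
           * ereal (\<rho> powr (2 * real m / real N)) < 1"
  shows "(\<nexists>u. is_arg_min (J m \<mu> Y g) (\<lambda>v. v \<in> constraint_set m \<mu> Y g \<inter> mass_ball \<rho>) u)
       \<and> (\<nexists>u. is_arg_min (J m \<mu> Y g) (\<lambda>v. v \<in> constraint_set m \<mu> Y g \<inter> mass_sphere \<rho>) u)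
       \<and> (\<nexists>lam u. normalized_ground_state m \<mu> Y g \<rho> lam u)"
proof -
  have "2 * m < card Y" using assms by simp
  note lower = exists_lower_energy[OF assms(1,2) this assms(6-9,12-15)]
  have ball: False if "is_arg_min (J m \<mu> Y g) (\<lambda>v. v \<in> constraint_set m \<mu> Y g \<inter> mass_ball \<rho>) u" for u
  proof -
    have u: "u \<in> constraint_set m \<mu> Y g" "(LINT x|lborel. (u x)\<^sup>2) \<le> \<rho>"
      using that by (auto simp: is_arg_min_def mass_ball_def)
    obtain w where "w \<in> constraint_set m \<mu> Y g" "w \<in> L2"
      "(LINT x|lborel. (w x)\<^sup>2) = (LINT x|lborel. (u x)\<^sup>2)" "J m \<mu> Y g w < J m \<mu> Y g u"
      using lower[OF u] by blast
    then show False using that u(2) by (auto simp: is_arg_min_def mass_ball_def)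
  qed
  have sphere: False if "is_arg_min (J m \<mu> Y g) (\<lambda>v. v \<in> constraint_set m \<mu> Y g \<inter> mass_sphere \<rho>) u" for u
  proof -
    have u: "u \<in> constraint_set m \<mu> Y g" "(LINT x|lborel. (u x)\<^sup>2) = \<rho>"
      using that by (auto simp: is_arg_min_def mass_sphere_def)
    obtain w where "w \<in> constraint_set m \<mu> Y g" "w \<in> L2"
      "(LINT x|lborel. (w x)\<^sup>2) = (LINT x|lborel. (u x)\<^sup>2)" "J m \<mu> Y g w < J m \<mu> Y g u"
      using lower[OF u(1) u(2)[THEN eq_refl]] by blast
    then show False using that u(2) by (auto simp: is_arg_min_def mass_sphere_def)
  qed
  show ?thesis
    using ball sphere unfolding normalized_ground_state_def by blast
qed

end
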